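(* The set $\mathbf{Q}=\{K : \mathbf{NP}^K\not\subseteq\mathbf{BQP}^K\}$ is Ramsey positive. Moreover, there exists an infinite set $H\subseteq\omega$ such that for every infinite $C\subseteq H$, $\mathbf{NP}^C\not\subseteq\mathbf{BQP}^C$.
   Context: Binary strings are identified with natural numbers via a fixed effective enumeration of $\{0,1\}^{<\omega}$, so that infinite oracles are identified with elements of $[\omega]^\omega$, the set of infinite subsets of $\omega$. $\mathbf{BQP}^C$ is the class of languages accepted with probability at least $2/3$ by polynomial-time oracle quantum Turing machines (Bernstein–Vazirani model) with oracle $C$. The Ellentuck topology on $[\omega]^\omega$ has basic open sets $[a,A]=\{S\in[\omega]^\omega : S\cap(\max a+1)=a,\ S\setminus a\subseteq A\}$ for finite $a$ and infinite $A$ with $\min A>\max a$. A set is Ramsey small if it is meager in the Ellentuck topology, and Ramsey positive if it is not Ramsey small. *)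

theory Defs
  imports "HOL-Analysis.Analysis" "HOL-Computational_Algebra.Polynomial"
begin

section \<open>Binary strings as natural numbers\<close>

text \<open>The length-lexicographic enumeration of the binary strings: the empty string, 0, 1, 00, 01, ...\<close>

fun bin_str :: "nat \<Rightarrow> bool list" where
  "bin_str 0 = []"
| "bin_str (Suc n) = bin_str (n div 2) @ [odd n]"

lemma bij_bin_str: "bij bin_str"
proof (rule bijI)
  show "inj bin_str"
  proof (rule injI)
    fix m n :: nat
    show "bin_str m = bin_str n \<Longrightarrow> m = n"
    proof (induction m arbitrary: n rule: bin_str.induct)
      case 1
      then show ?case by (cases n) auto
    next
      case (2 m)
      then obtain k where k: "n = Suc k" by (cases n) auto
      then have "m div 2 = k div 2" "odd m = odd k"
        using 2 by auto
      then show ?case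
        using k by (metis div_mult_mod_eq mod2_eq_if)
    qed
  qed
  show "surj bin_str"
  proof -
    have "\<exists>n. bin_str n = w" for w
    proof (induction w rule: rev_induct)
      case Nil
      then show ?case by (metis bin_str.simps(1))
    next
      case (snoc b w)
      then obtain n where "bin_str n = w" by blast
      then have "bin_str (Suc (2 * n + of_bool b)) = w @ [b]" by simp
      then show ?case by blast
    qed
    then show ?thesis by (metis surjI)
  qed
qed


section \<open>Tapes, configurations and oracle calls\<close>

text \<open>
  All machines have one two-way infinite tape and one head, as in Bernstein and Vazirani.  The tape
  has three tracks: a work track over an arbitrary finite alphabet, which also carries the input,
  and a query track and an answer track over blank, 0 and 1.  On the last two, \<open>None\<close> is the blank.
\<close>

datatype sym = Blank | Bit bool | Aux nat

record cell =
  work :: sym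
  query :: "bool option"
  ans :: "bool option"

definition blank_cell :: cell where
  "blank_cell = \<lparr>work = Blank, query = None, ans = None\<rparr>"

datatype dir = MoveL | MoveR

record config =
  cstate :: nat
  head :: int
  tape :: "int \<Rightarrow> cell"

record machine =
  states :: "nat set"
  alph :: "sym set"
  q_init :: nat
  q_final :: nat
  q_query :: nat
  q_answer :: nat

definition cells :: "('a) machine_scheme \<Rightarrow> cell set" where
  "cells M = {s. work s \<in> alph M}"

definition valid_machine :: "('a) machine_scheme \<Rightarrow> bool" where
  "valid_machine M \<longleftrightarrow>
     finite (states M) \<and> finite (alph M) \<and> {Blank, Bit False, Bit True} \<subseteq> alph M \<and>
     {q_init M, q_final M, q_query M, q_answer M} \<subseteq> states M \<and>
     distinct [q_init M, q_final M, q_query M, q_answer M]"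

definition configs :: "('a) machine_scheme \<Rightarrow> config set" where
  "configs M = {c. cstate c \<in> states M \<and> (\<forall>p. tape c p \<in> cells M) \<and>
                   finite {p. tape c p \<noteq> blank_cell}}"

definition init_config :: "('a) machine_scheme \<Rightarrow> bool list \<Rightarrow> config" where
  "init_config M x =
     \<lparr>cstate = q_init M, head = 0,
      tape = (\<lambda>p. if 0 \<le> p \<and> p < int (length x)
                  then blank_cell\<lparr>work := Bit (x ! nat p)\<rparr> else blank_cell)\<rparr>"

definition scanned :: "config \<Rightarrow> cell" where
  "scanned c = tape c (head c)"

definition apply_move :: "config \<Rightarrow> cell \<Rightarrow> nat \<Rightarrow> dir \<Rightarrow> config" where
  "apply_move c s q d =
     \<lparr>cstate = q, head = (case d of MoveL \<Rightarrow> head c - 1 | MoveR \<Rightarrow> head c + 1),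
      tape = (tape c)(head c := s)\<rparr>"

text \<open>The query track holds the word \<open>w\<close> from cell \<open>i\<close> on, and nothing else.\<close>

definition query_block :: "(int \<Rightarrow> cell) \<Rightarrow> int \<Rightarrow> bool list \<Rightarrow> bool" where
  "query_block t i w \<longleftrightarrow>
     (\<forall>p. query (t p) = (if i \<le> p \<and> p < i + int (length w) then Some (w ! nat (p - i)) else None))"

text \<open>
  An oracle call (Bennett, Bernstein, Brassard and Vazirani) replaces the query word \<open>x @ [b]\<close> by
  \<open>x @ [b XOR A(x)]\<close> and passes from the pre-query to the post-query state, everything else staying
  the same.  If the query track is blank, or its non-blank cells do not form one block, the tape is
  left alone.
\<close>

definition oracle_tape :: "bool list set \<Rightarrow> (int \<Rightarrow> cell) \<Rightarrow> int \<Rightarrow> cell" where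
  "oracle_tape A t = (\<lambda>p.
     if \<exists>i x b. query_block t i (x @ [b]) \<and> p = i + int (length x) \<and> x \<in> A
     then (t p)\<lparr>query := map_option Not (query (t p))\<rparr> else t p)"

definition oracle_call :: "('a) machine_scheme \<Rightarrow> bool list set \<Rightarrow> config \<Rightarrow> config" where
  "oracle_call M A c = \<lparr>cstate = q_answer M, head = head c, tape = oracle_tape A (tape c)\<rparr>"


section \<open>Nondeterministic oracle machines and relativized NP\<close>

record ntm = machine +
  delta :: "nat \<Rightarrow> cell \<Rightarrow> (cell \<times> nat \<times> dir) set"

definition valid_ntm :: "ntm \<Rightarrow> bool" where
  "valid_ntm M \<longleftrightarrow> valid_machine M \<and>
     (\<forall>q\<in>states M. \<forall>s\<in>cells M. delta M q s \<subseteq> cells M \<times> states M \<times> UNIV)"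

text \<open>The final state accepts; a configuration without a successor in any other state rejects.\<close>

definition nstep :: "ntm \<Rightarrow> bool list set \<Rightarrow> config \<Rightarrow> config \<Rightarrow> bool" where
  "nstep M A c c' \<longleftrightarrow> cstate c \<noteq> q_final M \<and>
     (if cstate c = q_query M then c' = oracle_call M A c
      else \<exists>(s, q, d) \<in> delta M (cstate c) (scanned c). c' = apply_move c s q d)"

definition ntm_poly_time :: "ntm \<Rightarrow> bool list set \<Rightarrow> bool" where
  "ntm_poly_time M A \<longleftrightarrow>
     (\<exists>p :: nat poly. \<forall>x k c. (nstep M A ^^ k) (init_config M x) c \<longrightarrow> k \<le> poly p (length x))"

definition ntm_accepts :: "ntm \<Rightarrow> bool list set \<Rightarrow> bool list \<Rightarrow> bool" where
  "ntm_accepts M A x \<longleftrightarrow> (\<exists>c. (nstep M A)\<^sup>*\<^sup>* (init_config M x) c \<and> cstate c = q_final M)"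

definition NP_str :: "bool list set \<Rightarrow> bool list set set" where
  "NP_str A = {L. \<exists>M. valid_ntm M \<and> ntm_poly_time M A \<and> L = {x. ntm_accepts M A x}}"


section \<open>Efficiently computable amplitudes\<close>

definition deterministic :: "ntm \<Rightarrow> bool" where
  "deterministic M \<longleftrightarrow>
     (\<forall>q\<in>states M. \<forall>s\<in>cells M. \<forall>u\<in>delta M q s. \<forall>v\<in>delta M q s. u = v)"

definition work_output :: "config \<Rightarrow> bool list \<Rightarrow> bool" where
  "work_output c w \<longleftrightarrow>
     (\<forall>i < length w. work (tape c (int i)) = Bit (w ! i)) \<and>
     work (tape c (int (length w))) = Blank"

text \<open>A sign bit followed by the binary digits of the absolute value, least significant first.\<close>

fun signed_value :: "bool list \<Rightarrow> int" where
  "signed_value [] = 0"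
| "signed_value (b # w) = (if b then -1 else 1) * horner_sum of_bool 2 w"

text \<open>
  A deterministic machine (without oracle) that, on input of \<open>n\<close> ones, outputs in time polynomial
  in \<open>n\<close> an integer \<open>a\<close> such that \<open>a / 2 ^ n\<close> approximates \<open>r\<close> to within \<open>1 / 2 ^ n\<close>.
\<close>

definition poly_time_real :: "real \<Rightarrow> bool" where
  "poly_time_real r \<longleftrightarrow>
     (\<exists>M (p :: nat poly). valid_ntm M \<and> deterministic M \<and>
        (\<forall>n. \<exists>k c w. k \<le> poly p n \<and>
           (nstep M {} ^^ k) (init_config M (replicate n True)) c \<and> cstate c = q_final M \<and>
           work_output c w \<and> \<bar>r - real_of_int (signed_value w) / 2 ^ n\<bar> \<le> 1 / 2 ^ n))"

definition poly_time_complex :: "complex \<Rightarrow> bool" where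
  "poly_time_complex z \<longleftrightarrow> poly_time_real (Re z) \<and> poly_time_real (Im z)"


section \<open>Oracle quantum Turing machines and relativized BQP\<close>

text \<open>\<open>amp M p s t q d\<close> is the amplitude of writing \<open>t\<close>, entering \<open>q\<close> and moving in direction \<open>d\<close>
  when scanning \<open>s\<close> in state \<open>p\<close>.\<close>

record qtm = machine +
  amp :: "nat \<Rightarrow> cell \<Rightarrow> cell \<Rightarrow> nat \<Rightarrow> dir \<Rightarrow> complex"

definition valid_qtm :: "qtm \<Rightarrow> bool" where
  "valid_qtm M \<longleftrightarrow> valid_machine M \<and>
     (\<forall>p\<in>states M. \<forall>s\<in>cells M. \<forall>t\<in>cells M. \<forall>q\<in>states M. \<forall>d. poly_time_complex (amp M p s t q d))"

type_synonym superpos = "config \<Rightarrow> complex"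

definition superpositions :: "qtm \<Rightarrow> superpos set" where
  "superpositions M = {\<psi>. finite {c. \<psi> c \<noteq> 0} \<and> {c. \<psi> c \<noteq> 0} \<subseteq> configs M}"

definition sq_norm :: "superpos \<Rightarrow> real" where
  "sq_norm \<psi> = (\<Sum>c | \<psi> c \<noteq> 0. (cmod (\<psi> c))\<^sup>2)"

text \<open>The matrix entry in column \<open>c\<close> and row \<open>c'\<close> of the time evolution operator with oracle \<open>A\<close>;
  an oracle call takes one step.\<close>

definition step_amp :: "qtm \<Rightarrow> bool list set \<Rightarrow> config \<Rightarrow> config \<Rightarrow> complex" where
  "step_amp M A c c' =
     (if cstate c = q_query M then of_bool (c' = oracle_call M A c)
      else (\<Sum>(t, q, d) \<in> cells M \<times> states M \<times> UNIV.
              of_bool (c' = apply_move c t q d) * amp M (cstate c) (scanned c) t q d))"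

definition evolve :: "qtm \<Rightarrow> bool list set \<Rightarrow> superpos \<Rightarrow> superpos" where
  "evolve M A \<psi> = (\<lambda>c'. \<Sum>c | \<psi> c \<noteq> 0. \<psi> c * step_amp M A c c')"

definition well_formed :: "qtm \<Rightarrow> bool list set \<Rightarrow> bool" where
  "well_formed M A \<longleftrightarrow> (\<forall>\<psi> \<in> superpositions M. sq_norm (evolve M A \<psi>) = sq_norm \<psi>)"

definition normal_form :: "qtm \<Rightarrow> bool" where
  "normal_form M \<longleftrightarrow>
     (\<forall>s\<in>cells M. \<forall>t\<in>cells M. \<forall>q\<in>states M. \<forall>d.
        amp M (q_final M) s t q d = of_bool (t = s \<and> q = q_init M \<and> d = MoveR))"

definition run :: "qtm \<Rightarrow> bool list set \<Rightarrow> bool list \<Rightarrow> nat \<Rightarrow> superpos" where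
  "run M A x k = (evolve M A ^^ k) (\<lambda>c. of_bool (c = init_config M x))"

definition halts_at :: "qtm \<Rightarrow> bool list set \<Rightarrow> bool list \<Rightarrow> nat \<Rightarrow> bool" where
  "halts_at M A x T \<longleftrightarrow>
     (\<forall>c. run M A x T c \<noteq> 0 \<longrightarrow> cstate c = q_final M) \<and>
     (\<forall>k<T. \<forall>c. run M A x k c \<noteq> 0 \<longrightarrow> cstate c \<noteq> q_final M)"

definition qtm_poly_time :: "qtm \<Rightarrow> bool list set \<Rightarrow> bool" where
  "qtm_poly_time M A \<longleftrightarrow>
     (\<exists>p :: nat poly. \<forall>x. \<exists>T \<le> poly p (length x). halts_at M A x T)"

definition stationary :: "qtm \<Rightarrow> bool list set \<Rightarrow> bool" where
  "stationary M A \<longleftrightarrow>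
     (\<forall>x. \<exists>T. halts_at M A x T \<and> (\<forall>c. run M A x T c \<noteq> 0 \<longrightarrow> head c = 0))"

text \<open>The probability of seeing a 1 when, at time \<open>T\<close>, the answer track of the start cell is
  observed.\<close>

definition accept_prob :: "qtm \<Rightarrow> bool list set \<Rightarrow> bool list \<Rightarrow> nat \<Rightarrow> real" where
  "accept_prob M A x T =
     (\<Sum>c | run M A x T c \<noteq> 0 \<and> ans (tape c 0) = Some True. (cmod (run M A x T c))\<^sup>2)"

definition qtm_accepts_lang :: "qtm \<Rightarrow> bool list set \<Rightarrow> bool list set \<Rightarrow> real \<Rightarrow> bool" where
  "qtm_accepts_lang M A L r \<longleftrightarrow>
     (\<forall>x T. halts_at M A x T \<longrightarrow>
        (x \<in> L \<longrightarrow> accept_prob M A x T \<ge> r) \<and>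
        (x \<notin> L \<longrightarrow> 1 - accept_prob M A x T \<ge> r))"

definition BQP_str :: "bool list set \<Rightarrow> bool list set set" where
  "BQP_str A = {L. \<exists>M. valid_qtm M \<and> well_formed M A \<and> normal_form M \<and>
                       qtm_poly_time M A \<and> stationary M A \<and> qtm_accepts_lang M A L (2/3)}"


section \<open>Oracles as sets of natural numbers\<close>

definition NP :: "nat set \<Rightarrow> bool list set set" where
  "NP K = NP_str (bin_str ` K)"

definition BQP :: "nat set \<Rightarrow> bool list set set" where
  "BQP K = BQP_str (bin_str ` K)"


section \<open>The Ellentuck topology\<close>

text \<open>The initial segment \<open>{n. \<exists>m\<in>a. n \<le> m}\<close> is \<open>max a + 1\<close>, and empty for empty \<open>a\<close>.\<close>

definition ellentuck_basic :: "nat set \<Rightarrow> nat set \<Rightarrow> nat set set" where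
  "ellentuck_basic a A = {S. infinite S \<and> S \<inter> {n. \<exists>m\<in>a. n \<le> m} = a \<and> S - a \<subseteq> A}"

definition ellentuck :: "nat set topology" where
  "ellentuck = topology_generated_by
     {ellentuck_basic a A | a A. finite a \<and> infinite A \<and> (\<forall>m\<in>a. \<forall>n\<in>A. m < n)}"

lemma topspace_ellentuck: "topspace ellentuck = {S. infinite S}"
proof
  show "topspace ellentuck \<subseteq> {S. infinite S}"
    unfolding ellentuck_def topology_generated_by_topspace
    by (auto simp: ellentuck_basic_def)
  have "ellentuck_basic {} UNIV = {S. infinite S}"
    by (auto simp: ellentuck_basic_def)
  moreover have "ellentuck_basic {} UNIV \<in>
      {ellentuck_basic a A | a A. finite a \<and> infinite A \<and> (\<forall>m\<in>a. \<forall>n\<in>A. m < n)}"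
    by (blast intro: infinite_UNIV_nat)
  ultimately show "{S. infinite S} \<subseteq> topspace ellentuck"
    unfolding ellentuck_def topology_generated_by_topspace by blast
qed

definition nowhere_dense_in :: "'a topology \<Rightarrow> 'a set \<Rightarrow> bool" where
  "nowhere_dense_in X S \<longleftrightarrow> S \<subseteq> topspace X \<and> X interior_of (X closure_of S) = {}"

definition meager_in :: "'a topology \<Rightarrow> 'a set \<Rightarrow> bool" where
  "meager_in X S \<longleftrightarrow> (\<exists>\<N>. countable \<N> \<and> (\<forall>N\<in>\<N>. nowhere_dense_in X N) \<and> S = \<Union>\<N>)"

definition ramsey_small :: "nat set set \<Rightarrow> bool" where
  "ramsey_small S \<longleftrightarrow> meager_in ellentuck S"

definition ramsey_positive :: "nat set set \<Rightarrow> bool" where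
  "ramsey_positive S \<longleftrightarrow> S \<subseteq> {K. infinite K} \<and> \<not> ramsey_small S"

end

theory Submission
  imports Defs
begin

text \<open>
  Choose words \<open>x\<^sub>0, x\<^sub>1, \<dots>\<close> of rapidly increasing lengths and let \<open>H\<close> be the set of their codes.  For
  \<open>A \<subseteq> {x\<^sub>0, x\<^sub>1, \<dots>}\<close> consider the NP language of all \<open>y\<close> such that some \<open>x \<in> A\<close> of the same
  length has a 1 in common with \<open>y\<close>; its values on the unit words of length \<open>n\<close> spell out the
  word of length \<open>n\<close> in \<open>A\<close>.  Fix a machine and a finite set \<open>F\<close> of earlier words.  By the hybrid
  argument, oracles \<open>F \<union> {x}\<close> and \<open>F\<close> are hard to tell apart unless the run with oracle \<open>F\<close> queries
  \<open>x\<close> with large weight.  Only polynomially many \<open>x\<close> of length \<open>n\<close> are of that kind, and of the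
  remaining ones at most one can be spelled out correctly.  There are countably many machines and time
  bounds and, at each stage, finitely many \<open>F\<close>, so a common hard word exists at every stage.  Later
  words are too long to be queried.  Hence every infinite \<open>C \<subseteq> H\<close> separates the classes.  These \<open>C\<close>
  form a nonempty open set, which is not meager, because the Ellentuck space is a Baire space: in the
  usual fusion argument, the intersection of the chosen basic sets contains an infinite set.
\<close>

section \<open>The Baire property of the Ellentuck topology\<close>

text \<open>Induction on the generation of open sets. For a basic set every \<open>k\<close> beyond
  the stem works. Asking for all large \<open>k\<close> settles intersections by a maximum and lets
  later proofs enlarge \<open>k\<close> freely.\<close>

lemma ellentuck_nbhd:
  assumes "openin ellentuck U" "S \<in> U"
  shows "\<exists>m. \<forall>k\<ge>m. ellentuck_basic (S \<inter> {..k}) (S \<inter> {k<..}) \<subseteq> U"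
proof -
  have "generate_topology_on
     {ellentuck_basic a A | a A. finite a \<and> infinite A \<and> (\<forall>m\<in>a. \<forall>n\<in>A. m < n)} U"
    using assms(1) by (simp add: ellentuck_def openin_topology_generated_by_iff)
  then show ?thesis
    using assms(2)
  proof (induction arbitrary: S rule: generate_topology_on.induct)
    case Empty
    then show ?case by simp
  next
    case (Int U V)
    then obtain m n where
      "\<forall>k\<ge>m. ellentuck_basic (S \<inter> {..k}) (S \<inter> {k<..}) \<subseteq> U"
      "\<forall>k\<ge>n. ellentuck_basic (S \<inter> {..k}) (S \<inter> {k<..}) \<subseteq> V"
      by (meson IntD1 IntD2)
    then have "\<forall>k\<ge>max m n. ellentuck_basic (S \<inter> {..k}) (S \<inter> {k<..}) \<subseteq> U \<inter> V"
      by simp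
    then show ?case by blast
  next
    case (UN K)
    then show ?case by (meson Sup_upper UnionE subset_trans)
  next
    case (Basis U)
    then obtain a A where U: "U = ellentuck_basic a A" and "finite a"
      and aA: "\<forall>m\<in>a. \<forall>n\<in>A. m < n" by blast
    obtain m where m: "\<forall>n\<in>a. n \<le> m"
      using \<open>finite a\<close> finite_nat_set_iff_bounded_le by blast
    have "ellentuck_basic (S \<inter> {..k}) (S \<inter> {k<..}) \<subseteq> U" if "k \<ge> m" for k
    proof
      fix R assume R: "R \<in> ellentuck_basic (S \<inter> {..k}) (S \<inter> {k<..})"
      have S: "S \<inter> {n. \<exists>m\<in>a. n \<le> m} = a" "S - a \<subseteq> A"
        using Basis(2) unfolding U ellentuck_basic_def by auto
      have "infinite R" "R \<subseteq> S"
        and R': "R \<inter> {n. \<exists>m\<in>S \<inter> {..k}. n \<le> m} = S \<inter> {..k}"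
        using R unfolding ellentuck_basic_def by auto
      have "a \<subseteq> S \<inter> {..k}" using S(1) m that by auto
      then have "R \<inter> {n. \<exists>m\<in>a. n \<le> m} = a"
        using R' S(1) \<open>R \<subseteq> S\<close> by blast
      then show "R \<in> U"
        using S \<open>R \<subseteq> S\<close> \<open>infinite R\<close> unfolding U ellentuck_basic_def by blast
    qed
    then show ?case by blast
  qed
qed

lemma openin_ellentuck_basic:
  assumes "finite a" "infinite A" "\<forall>m\<in>a. \<forall>n\<in>A. m < n"
  shows "openin ellentuck (ellentuck_basic a A)"
  unfolding ellentuck_def using assms
  by (auto intro!: topology_generated_by_Basis)

lemma ellentuck_Baire:
  assumes "infinite H" and nd: "\<And>i::nat. nowhere_dense_in ellentuck (N i)"
  shows "\<exists>S. infinite S \<and> S \<subseteq> H \<and> (\<forall>i. S \<notin> N i)"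
proof -
  \<comment> \<open>Neighbourhoods of \<open>S\<close>: the infinite subsets of \<open>S\<close>
    that agree with \<open>S\<close> up to \<open>m\<close>.\<close>
  define B where "B S m = ellentuck_basic (S \<inter> {..m}) (S \<inter> {m<..})" for S :: "nat set" and m :: nat
  have infB: "infinite (S \<inter> {m<..})" if "infinite S" for S and m :: nat
  proof
    assume "finite (S \<inter> {m<..})"
    moreover have "S \<subseteq> {..m} \<union> (S \<inter> {m<..})" by auto
    ultimately show False using that finite_subset by blast
  qed
  have opB: "openin ellentuck (B S m)" if "infinite S" for S m
    unfolding B_def using infB[OF that] by (intro openin_ellentuck_basic) auto
  have selfB: "S \<in> B S m" if "infinite S" for S m
    unfolding B_def ellentuck_basic_def using that by auto
  have subB: "R \<subseteq> S" "R \<inter> {..m} = S \<inter> {..m}" "infinite R" if "R \<in> B S m" for R S m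
  proof -
    show "R \<subseteq> S" "infinite R" using that unfolding B_def ellentuck_basic_def by auto
    have "S \<inter> {..m} \<subseteq> R" using that unfolding B_def ellentuck_basic_def by auto
    then show "R \<inter> {..m} = S \<inter> {..m}" using \<open>R \<subseteq> S\<close> by auto
  qed
  \<comment> \<open>One fusion step. Nowhere density gives an \<open>R\<close> off the closure of
    \<open>N i\<close>, and some neighbourhood of \<open>R\<close> then avoids \<open>N i\<close>.
    The bound \<open>k\<close> is raised until a further element of \<open>R\<close> is frozen,
    which keeps the limit infinite.\<close>
  have step: "\<exists>R k. R \<in> B S m \<and> m < k \<and> R \<inter> {m<..k} \<noteq> {} \<and> B R k \<inter> N i = {}"
    if S: "infinite S" for S m i
  proof -
    let ?C = "ellentuck closure_of (N i)"
    have "\<not> B S m \<subseteq> ?C"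
    proof
      assume "B S m \<subseteq> ?C"
      then have "S \<in> ellentuck interior_of ?C"
        using opB[OF S] selfB[OF S] unfolding interior_of_def by blast
      then show False using nd[of i] unfolding nowhere_dense_in_def by blast
    qed
    then obtain R where R: "R \<in> B S m" "R \<notin> ?C" by blast
    have "openin ellentuck (topspace ellentuck - ?C)"
      by (rule openin_diff[OF openin_topspace closedin_closure_of])
    moreover have "R \<in> topspace ellentuck - ?C"
      using R subB(3)[OF R(1)] by (simp add: topspace_ellentuck)
    ultimately obtain l where l: "\<forall>k\<ge>l. B R k \<subseteq> topspace ellentuck - ?C"
      using ellentuck_nbhd unfolding B_def by metis
    obtain r where r: "r \<in> R" "m < r"
      using subB(3)[OF R(1)] by (meson infinite_nat_iff_unbounded)
    have "N i \<subseteq> ?C"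
      using nd[of i] unfolding nowhere_dense_in_def by (simp add: closure_of_subset)
    then have "B R (max l r) \<inter> N i = {}" using l by (meson Diff_disjoint disjoint_iff max.cobounded1 subset_iff DiffD2)
    moreover have "R \<inter> {m<..max l r} \<noteq> {}" "m < max l r" using r by auto
    ultimately show ?thesis using R(1) by blast
  qed
  define P where "P s = infinite (fst s)" for s :: "nat set \<times> nat"
  define Q where "Q i s t \<longleftrightarrow> fst t \<in> B (fst s) (snd s) \<and> snd s < snd t \<and>
      fst t \<inter> {snd s<..snd t} \<noteq> {} \<and> B (fst t) (snd t) \<inter> N i = {}"
    for i :: nat and s t :: "nat set \<times> nat"
  \<comment> \<open>The clause for \<open>i = 0\<close> makes the sequence start at
    \<open>H\<close>; dependent choice alone would leave the first term open.\<close>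
  have "\<exists>f. \<forall>i. P (f i) \<and> Q i (f i) (f (Suc i)) \<and> (i = 0 \<longrightarrow> f i = (H, 0))"
  proof -
    have "\<exists>f. \<forall>i. (P (f i) \<and> (i = 0 \<longrightarrow> f i = (H, 0))) \<and> Q i (f i) (f (Suc i))"
    proof (rule dependent_nat_choice)
      show "\<exists>x. P x \<and> ((0::nat) = 0 \<longrightarrow> x = (H, 0))" using assms(1) by (simp add: P_def)
      fix x and i :: nat assume "P x \<and> (i = 0 \<longrightarrow> x = (H, 0))"
      then obtain R k where "R \<in> B (fst x) (snd x) \<and> snd x < k \<and> R \<inter> {snd x<..k} \<noteq> {} \<and> B R k \<inter> N i = {}"
        using step[of "fst x" "snd x" i] unfolding P_def by blast
      then have "P (R, k) \<and> Q i x (R, k)" unfolding P_def Q_def using subB(3) by auto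
      then show "\<exists>y. (P y \<and> (Suc i = 0 \<longrightarrow> y = (H, 0))) \<and> Q i x y" by auto
    qed
    then show ?thesis by blast
  qed
  then obtain f where f: "\<And>i. P (f i)" "\<And>i. Q i (f i) (f (Suc i))" "f 0 = (H, 0)" by blast
  define S where "S i = fst (f i)" for i
  define m where "m i = snd (f i)" for i
  have Sm: "S (Suc i) \<in> B (S i) (m i)" "m i < m (Suc i)" "S (Suc i) \<inter> {m i<..m (Suc i)} \<noteq> {}"
    "B (S (Suc i)) (m (Suc i)) \<inter> N i = {}" for i
    using f(2)[of i] unfolding Q_def S_def m_def by auto
  have "strict_mono m" using Sm(2) by (simp add: strict_mono_Suc_iff)
  then have mono_m: "m i \<le> m j" if "i \<le> j" for i j
    using that by (simp add: strict_mono_less_eq)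
  have "decseq S" by (rule decseq_SucI) (rule subB(1)[OF Sm(1)])
  then have anti: "S j \<subseteq> S i" if "i \<le> j" for i j
    using that by (rule decseqD)
  have agree: "S j \<inter> {..m i} = S i \<inter> {..m i}" if "i \<le> j" for i j
    using that
  proof (induction j rule: dec_induct)
    case (step n)
    have "{..m n} \<inter> {..m i} = {..m i}" using mono_m[OF step(1)] by (simp add: Int_absorb1)
    then have "S (Suc n) \<inter> {..m i} = S (Suc n) \<inter> {..m n} \<inter> {..m i}" by (simp add: Int_assoc)
    also have "\<dots> = S n \<inter> {..m n} \<inter> {..m i}" by (simp only: subB(2)[OF Sm(1)])
    also have "\<dots> = S n \<inter> {..m i}"
      using \<open>{..m n} \<inter> {..m i} = {..m i}\<close> by (simp add: Int_assoc)
    finally show ?case using step(3) by simp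
  qed simp
  \<comment> \<open>The fusion: whatever stage \<open>i\<close> decides up to \<open>m i\<close> is
    never changed again, so the intersection keeps it.\<close>
  define R where "R = (\<Inter>i. S i)"
  have R: "R \<inter> {..m i} = S i \<inter> {..m i}" for i
  proof
    show "S i \<inter> {..m i} \<subseteq> R \<inter> {..m i}"
    proof
      fix x assume x: "x \<in> S i \<inter> {..m i}"
      have "x \<in> S j" for j
      proof (cases "i \<le> j")
        case True
        then show ?thesis using agree[OF True] x by blast
      next
        case False
        then show ?thesis using anti[of j i] x by auto
      qed
      then show "x \<in> R \<inter> {..m i}" using x unfolding R_def by blast
    qed
  qed (auto simp: R_def)
  \<comment> \<open>The element frozen between \<open>m b\<close> and \<open>m (Suc b)\<close>
    exceeds any proposed bound \<open>b\<close>, because \<open>b \<le> m b\<close>.\<close>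
  have "infinite R"
  proof
    assume "finite R"
    then obtain b where b: "\<forall>x\<in>R. x \<le> b" using finite_nat_set_iff_bounded_le by blast
    have "i \<le> m i" for i
      using Sm(2) by (induction i) (auto simp: Suc_le_eq intro: le_less_trans)
    then have "b \<le> m b" .
    obtain x where "x \<in> S (Suc b)" "m b < x" "x \<le> m (Suc b)" using Sm(3)[of b] by auto
    then have "x \<in> R" using R[of "Suc b"] by auto
    then show False using b \<open>b \<le> m b\<close> \<open>m b < x\<close> by fastforce
  qed
  moreover have "R \<subseteq> H" using f(3) unfolding R_def S_def by (metis Inter_lower fst_conv rangeI)
  moreover have "R \<notin> N i" for i
  proof -
    have "R \<subseteq> S (Suc i)" unfolding R_def by blast
    moreover have "S (Suc i) \<inter> {n. \<exists>l\<in>S (Suc i) \<inter> {..m (Suc i)}. n \<le> l} = S (Suc i) \<inter> {..m (Suc i)}"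
      by auto
    ultimately have "R \<in> B (S (Suc i)) (m (Suc i))"
      using \<open>infinite R\<close> R[of "Suc i"] unfolding B_def ellentuck_basic_def by auto
    then show ?thesis using Sm(4)[of i] by blast
  qed
  ultimately show ?thesis by blast
qed

text \<open>A meager \<open>Q\<close> would be a countable union of nowhere dense sets, and the
  fusion finds an infinite subset of \<open>H\<close> outside all of them.\<close>

lemma not_ramsey_small:
  assumes "infinite H" and "\<And>C. infinite C \<Longrightarrow> C \<subseteq> H \<Longrightarrow> C \<in> Q"
  shows "\<not> ramsey_small Q"
proof
  assume "ramsey_small Q"
  then obtain \<N> where \<N>: "countable \<N>" "\<forall>N\<in>\<N>. nowhere_dense_in ellentuck N" "Q = \<Union>\<N>"
    unfolding ramsey_small_def meager_in_def by blast
  \<comment> \<open>\<open>H\<close> itself lies in \<open>Q\<close>, so the family is nonempty and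
    can be enumerated by the natural numbers.\<close>
  then have "\<N> \<noteq> {}" using assms by blast
  then obtain N :: "nat \<Rightarrow> _" where N: "range N = \<N>" using \<N>(1) by (metis range_from_nat_into)
  obtain S where "infinite S" "S \<subseteq> H" "\<forall>i. S \<notin> N i"
    using ellentuck_Baire[OF assms(1), of N] \<N>(2) N by blast
  then show False using assms(2)[of S] \<N>(3) N by blast
qed

section \<open>Oracle calls\<close>

lemma query_block_in:
  "query_block t i w \<Longrightarrow> query (t p) \<noteq> None \<longleftrightarrow> i \<le> p \<and> p < i + int (length w)"
  by (auto simp: query_block_def)

text \<open>The non-blank query cells form the interval occupied by the word, which fixes its
  position, its length and then its letters. The empty word must be excluded: on a blank track it
  fits everywhere.\<close>

lemma query_block_unique:
  assumes t: "query_block t i w" "query_block t j v" and "w \<noteq> []"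
  shows "i = j \<and> w = v"
proof -
  have eq: "i \<le> p \<and> p < i + int (length w) \<longleftrightarrow> j \<le> p \<and> p < j + int (length v)" for p
    using query_block_in[OF t(1)] query_block_in[OF t(2)] by blast
  have "length w > 0" using assms(3) by simp
  have i: "j \<le> i \<and> i < j + int (length v)"
    using iffD1[OF eq[of i]] \<open>length w > 0\<close> by linarith
  then have "i \<le> j" using iffD2[OF eq[of j]] by linarith
  with i have ij: "i = j" by simp
  have l1: "length w \<le> length v"
    using eq[of "i + int (length w) - 1"] ij \<open>length w > 0\<close> by simp
  have "length v > 0" using l1 \<open>length w > 0\<close> by linarith
  then have "length v \<le> length w"
    using eq[of "i + int (length v) - 1"] ij by simp
  with l1 have len: "length w = length v" by simp
  have "w ! n = v ! n" if "n < length w" for n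
  proof -
    have "query (t (i + int n)) = Some (w ! n)" "query (t (j + int n)) = Some (v ! n)"
      using t[unfolded query_block_def, THEN spec, of "i + int n"] that len ij by simp_all
    then show ?thesis using ij by simp
  qed
  with len ij show ?thesis by (simp add: list_eq_iff_nth_eq)
qed

text \<open>By uniqueness of the block, the existential in \<open>oracle_tape\<close> picks out one
  cell, the one holding the target bit.\<close>

lemma oracle_tape_block:
  assumes "query_block t i (x @ [b])"
  shows "oracle_tape A t =
    (if x \<in> A then t(i + int (length x) := (t (i + int (length x)))\<lparr>query := Some (\<not> b)\<rparr>) else t)"
proof -
  have q: "query (t (i + int (length x))) = Some b"
    using assms unfolding query_block_def by auto
  have "(\<exists>j y c. query_block t j (y @ [c]) \<and> p = j + int (length y) \<and> y \<in> A) \<longleftrightarrow>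
      p = i + int (length x) \<and> x \<in> A" for p
  proof -
    have "j = i \<and> y = x" if "query_block t j (y @ [c])" for j y c
      using query_block_unique[OF assms that] by simp
    then show ?thesis using assms by blast
  qed
  then show ?thesis
    unfolding oracle_tape_def by (simp add: q fun_eq_iff)
qed

lemma oracle_tape_no_block:
  assumes "\<And>i x b. \<not> query_block t i (x @ [b])"
  shows "oracle_tape A t = t"
  using assms unfolding oracle_tape_def by simp

lemma query_block_flip:
  assumes "query_block t i (x @ [b])"
  shows "query_block (t(i + int (length x) := (t (i + int (length x)))\<lparr>query := Some c\<rparr>)) i (x @ [c])"
  using assms unfolding query_block_def by (auto simp: nth_append)

text \<open>A call changes only the target bit, so the second call asks about the same word and
  flips the same cell back.\<close>

lemma oracle_tape_involution: "oracle_tape A (oracle_tape A t) = t"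
proof (cases "\<exists>i x b. query_block t i (x @ [b])")
  case True
  then obtain i x b where t: "query_block t i (x @ [b])" by blast
  have q: "query (t (i + int (length x))) = Some b"
    using t unfolding query_block_def by auto
  then have "(t (i + int (length x)))\<lparr>query := Some b\<rparr> = t (i + int (length x))"
    by (metis cell.surjective cell.update_convs(2))
  then show ?thesis
    using oracle_tape_block[OF query_block_flip[OF t]]
    by (auto simp: oracle_tape_block[OF t])
next
  case False
  then show ?thesis using oracle_tape_no_block by simp
qed

lemma work_oracle_tape [simp]: "work (oracle_tape A t p) = work (t p)"
  by (simp add: oracle_tape_def)

lemma oracle_tape_None_iff [simp]: "query (oracle_tape A t p) = None \<longleftrightarrow> query (t p) = None"
  by (simp add: oracle_tape_def)

lemma oracle_tape_blank: "t p = blank_cell \<Longrightarrow> oracle_tape A t p = blank_cell"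
  by (simp add: oracle_tape_def blank_cell_def)

lemma oracle_tape_cells [simp]: "oracle_tape A t p \<in> cells M \<longleftrightarrow> t p \<in> cells M"
  by (simp add: cells_def)

lemma finite_cells: 
  assumes "finite (alph M)" shows "finite (cells M)"
proof (rule inj_on_finite)
  show "inj_on (\<lambda>s. (work s, query s, ans s)) (cells M)" by (auto intro!: inj_onI)
  show "(\<lambda>s. (work s, query s, ans s)) ` cells M \<subseteq> alph M \<times> UNIV \<times> UNIV"
    by (auto simp: cells_def)
  show "finite (alph M \<times> (UNIV :: bool option set) \<times> (UNIV :: bool option set))"
    using assms by simp
qed

lemma configs_tape_update:
  assumes "c \<in> configs M" "q \<in> states M"
  shows "\<lparr>cstate = q, head = h, tape = oracle_tape A (tape c)\<rparr> \<in> configs M"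
proof -
  have "{p. oracle_tape A (tape c) p \<noteq> blank_cell} \<subseteq> {p. tape c p \<noteq> blank_cell}"
    using oracle_tape_blank by blast
  moreover have "finite {p. tape c p \<noteq> blank_cell}" using assms(1) by (simp add: configs_def)
  ultimately have "finite {p. oracle_tape A (tape c) p \<noteq> blank_cell}" by (rule finite_subset)
  then show ?thesis
    using assms by (simp add: configs_def)
qed

lemma oracle_call_configs:
  "valid_machine M \<Longrightarrow> c \<in> configs M \<Longrightarrow> oracle_call M A c \<in> configs M"
  unfolding oracle_call_def by (intro configs_tape_update) (auto simp: valid_machine_def)

lemma apply_move_configs:
  assumes "c \<in> configs M" "s \<in> cells M" "q \<in> states M"
  shows "apply_move c s q d \<in> configs M"
proof -
  have "{p. ((tape c)(head c := s)) p \<noteq> blank_cell} \<subseteq> insert (head c) {p. tape c p \<noteq> blank_cell}"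
    by auto
  moreover have "finite {p. tape c p \<noteq> blank_cell}" using assms(1) by (simp add: configs_def)
  ultimately have "finite {p. ((tape c)(head c := s)) p \<noteq> blank_cell}"
    by (metis finite_insert finite_subset)
  then show ?thesis
    using assms by (simp add: configs_def apply_move_def)
qed

lemma init_config_configs:
  assumes "valid_machine M" shows "init_config M x \<in> configs M"
proof -
  have "{p. tape (init_config M x) p \<noteq> blank_cell} \<subseteq> {0..<int (length x)}"
    unfolding init_config_def by auto
  moreover have "Bit b \<in> alph M" for b
    using assms unfolding valid_machine_def by (cases b) auto
  ultimately show ?thesis
    using assms finite_subset[of _ "{0..<int (length x)}"]
    unfolding configs_def
    by (auto simp: init_config_def cells_def blank_cell_def valid_machine_def)
qed

text \<open>The last letter \<open>b\<close> is the target bit, so both of its values count as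
  asking about \<open>x\<close>.\<close>

definition querying :: "('a) machine_scheme \<Rightarrow> bool list \<Rightarrow> config set" where
  "querying M x = {c. cstate c = q_query M \<and> (\<exists>i b. query_block (tape c) i (x @ [b]))}"

lemma querying_disjoint: "x \<noteq> y \<Longrightarrow> querying M x \<inter> querying M y = {}"
  unfolding querying_def using query_block_unique by fastforce

lemma oracle_tape_cong:
  assumes "\<And>i x b. query_block t i (x @ [b]) \<Longrightarrow> x \<in> A \<longleftrightarrow> x \<in> B"
  shows "oracle_tape A t = oracle_tape B t"
proof (cases "\<exists>i x b. query_block t i (x @ [b])")
  case True
  then show ?thesis using assms oracle_tape_block by metis
next
  case False
  then show ?thesis using oracle_tape_no_block by simp
qed

lemma oracle_call_insert:
  assumes "c \<notin> querying M x" "cstate c = q_query M"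
  shows "oracle_call M (insert x A) c = oracle_call M A c"
  unfolding oracle_call_def using assms
  by (auto simp: querying_def intro!: oracle_tape_cong)

section \<open>Superpositions and the hybrid argument\<close>

definition vnorm :: "superpos \<Rightarrow> real" where
  "vnorm \<psi> = sqrt (sq_norm \<psi>)"

text \<open>The Born probability of \<open>S\<close>, which is also the squared norm of the part of
  \<open>\<psi>\<close> supported on \<open>S\<close>.\<close>

definition prob :: "config set \<Rightarrow> superpos \<Rightarrow> real" where
  "prob S \<psi> = (\<Sum>c | \<psi> c \<noteq> 0 \<and> c \<in> S. (cmod (\<psi> c))\<^sup>2)"

lemma prob_eq:
  assumes "finite D" "{c. \<psi> c \<noteq> 0} \<subseteq> D"
  shows "prob S \<psi> = (\<Sum>c\<in>D \<inter> S. (cmod (\<psi> c))\<^sup>2)"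
  unfolding prob_def using assms by (intro sum.mono_neutral_left) auto

lemma sq_norm_prob: "sq_norm \<psi> = prob UNIV \<psi>"
  by (simp add: sq_norm_def prob_def)

lemma sq_norm_eq:
  assumes "finite D" "{c. \<psi> c \<noteq> 0} \<subseteq> D"
  shows "sq_norm \<psi> = (\<Sum>c\<in>D. (cmod (\<psi> c))\<^sup>2)"
  unfolding sq_norm_prob using prob_eq[OF assms, of UNIV] by simp

lemma vnorm_eq:
  assumes "finite D" "{c. \<psi> c \<noteq> 0} \<subseteq> D"
  shows "vnorm \<psi> = L2_set (\<lambda>c. cmod (\<psi> c)) D"
  unfolding vnorm_def L2_set_def sq_norm_eq[OF assms] ..

lemma prob_nonneg: "0 \<le> prob S \<psi>"
  unfolding prob_def by (intro sum_nonneg) auto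

lemma vnorm_add:
  assumes "finite {c. \<phi> c \<noteq> 0}" "finite {c. \<psi> c \<noteq> 0}"
  shows "vnorm (\<lambda>c. \<phi> c + \<psi> c) \<le> vnorm \<phi> + vnorm \<psi>"
proof -
  let ?D = "{c. \<phi> c \<noteq> 0} \<union> {c. \<psi> c \<noteq> 0}"
  have D: "finite ?D" using assms by simp
  have "vnorm (\<lambda>c. \<phi> c + \<psi> c) = L2_set (\<lambda>c. cmod (\<phi> c + \<psi> c)) ?D"
    using D by (intro vnorm_eq) auto
  also have "\<dots> \<le> L2_set (\<lambda>c. cmod (\<phi> c) + cmod (\<psi> c)) ?D"
    by (intro L2_set_mono) (auto intro: norm_triangle_ineq)
  also have "\<dots> \<le> L2_set (\<lambda>c. cmod (\<phi> c)) ?D + L2_set (\<lambda>c. cmod (\<psi> c)) ?D"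
    by (rule L2_set_triangle_ineq)
  also have "\<dots> = vnorm \<phi> + vnorm \<psi>"
    using D by (simp add: vnorm_eq[of ?D])
  finally show ?thesis .
qed

lemma vnorm_minus_swap: "vnorm (\<lambda>c. \<phi> c - \<psi> c) = vnorm (\<lambda>c. \<psi> c - \<phi> c)"
proof -
  have "sq_norm (\<lambda>c. \<phi> c - \<psi> c) = sq_norm (\<lambda>c. \<psi> c - \<phi> c)"
    unfolding sq_norm_def by (intro sum.cong) (auto simp: norm_minus_commute)
  then show ?thesis by (simp add: vnorm_def)
qed

lemma vnorm_diff:
  assumes "finite {c. \<phi> c \<noteq> 0}" "finite {c. \<psi> c \<noteq> 0}"
  shows "vnorm (\<lambda>c. \<phi> c - \<psi> c) \<le> vnorm \<phi> + vnorm \<psi>"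
proof -
  have "sq_norm (\<lambda>c. - \<psi> c) = sq_norm \<psi>" by (simp add: sq_norm_def)
  then have "vnorm (\<lambda>c. - \<psi> c) = vnorm \<psi>" by (simp add: vnorm_def)
  then show ?thesis using vnorm_add[of \<phi> "\<lambda>c. - \<psi> c"] assms by simp
qed

lemma finite_supp_diff:
  fixes \<phi> \<psi> :: superpos
  assumes "finite {c. \<phi> c \<noteq> 0}" "finite {c. \<psi> c \<noteq> 0}"
  shows "finite {c. \<phi> c - \<psi> c \<noteq> 0}"
  by (rule finite_subset[of _ "{c. \<phi> c \<noteq> 0} \<union> {c. \<psi> c \<noteq> 0}"]) (use assms in auto)

text \<open>Each probability is the square of a restricted norm \<open>l\<close>. In the difference
  of squares the sum of the two norms is at most 2, and their difference is bounded by the triangle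
  inequality.\<close>

lemma prob_diff:
  assumes fin: "finite {c. \<phi> c \<noteq> 0}" "finite {c. \<psi> c \<noteq> 0}"
    and "vnorm \<phi> = 1" "vnorm \<psi> = 1"
  shows "\<bar>prob S \<phi> - prob S \<psi>\<bar> \<le> 2 * vnorm (\<lambda>c. \<phi> c - \<psi> c)"
proof -
  let ?D = "{c. \<phi> c \<noteq> 0} \<union> {c. \<psi> c \<noteq> 0}"
  define l where "l \<theta> = L2_set (\<lambda>c. cmod (\<theta> c)) (?D \<inter> S)" for \<theta> :: superpos
  have D: "finite ?D" using fin by simp
  have l_mono: "l \<theta> \<le> vnorm \<theta>" if "{c. \<theta> c \<noteq> 0} \<subseteq> ?D" for \<theta>
    unfolding vnorm_eq[OF D that] l_def L2_set_def
    using D by (intro real_sqrt_le_mono sum_mono2) auto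
  have sq: "prob S \<theta> = (l \<theta>)\<^sup>2" if "{c. \<theta> c \<noteq> 0} \<subseteq> ?D" for \<theta>
    unfolding l_def L2_set_def using prob_eq[OF D that] by (simp add: sum_nonneg)
  have tri: "l \<theta> \<le> l \<eta> + l (\<lambda>c. \<phi> c - \<psi> c)"
    if "\<And>c. cmod (\<theta> c) \<le> cmod (\<eta> c) + cmod (\<phi> c - \<psi> c)" for \<theta> \<eta>
  proof -
    have "l \<theta> \<le> L2_set (\<lambda>c. cmod (\<eta> c) + cmod (\<phi> c - \<psi> c)) (?D \<inter> S)"
      unfolding l_def using that by (intro L2_set_mono) auto
    also have "\<dots> \<le> l \<eta> + l (\<lambda>c. \<phi> c - \<psi> c)"
      unfolding l_def by (rule L2_set_triangle_ineq)
    finally show ?thesis .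
  qed
  have "l \<phi> \<le> l \<psi> + l (\<lambda>c. \<phi> c - \<psi> c)"
    by (rule tri) (metis add.commute diff_add_cancel norm_triangle_ineq)
  moreover have "l \<psi> \<le> l \<phi> + l (\<lambda>c. \<phi> c - \<psi> c)"
    by (rule tri) (metis norm_minus_commute norm_triangle_sub)
  moreover have "l (\<lambda>c. \<phi> c - \<psi> c) \<le> vnorm (\<lambda>c. \<phi> c - \<psi> c)"
    by (rule l_mono) auto
  ultimately have d: "\<bar>l \<phi> - l \<psi>\<bar> \<le> vnorm (\<lambda>c. \<phi> c - \<psi> c)" by linarith
  have "l \<phi> \<le> 1" "l \<psi> \<le> 1"
    using l_mono[of \<phi>] l_mono[of \<psi>] assms(3,4) by auto
  moreover have "0 \<le> l \<phi>" "0 \<le> l \<psi>" unfolding l_def by simp_all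
  ultimately have s: "\<bar>l \<phi> + l \<psi>\<bar> \<le> 2" by linarith
  have "prob S \<phi> - prob S \<psi> = (l \<phi> + l \<psi>) * (l \<phi> - l \<psi>)"
    using sq[of \<phi>] sq[of \<psi>] by (simp add: power2_eq_square algebra_simps)
  then have "\<bar>prob S \<phi> - prob S \<psi>\<bar> = \<bar>l \<phi> + l \<psi>\<bar> * \<bar>l \<phi> - l \<psi>\<bar>" by (simp add: abs_mult)
  also have "\<dots> \<le> 2 * vnorm (\<lambda>c. \<phi> c - \<psi> c)" using d s by (intro mult_mono) auto
  finally show ?thesis .
qed

section \<open>Linearity and finite support of the time evolution\<close>

lemma evolve_eq:
  assumes "finite D" "{c. \<psi> c \<noteq> 0} \<subseteq> D"
  shows "evolve M A \<psi> c' = (\<Sum>c\<in>D. \<psi> c * step_amp M A c c')"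
  unfolding evolve_def using assms by (intro sum.mono_neutral_left) auto

lemma evolve_diff:
  assumes "finite {c. \<phi> c \<noteq> 0}" "finite {c. \<psi> c \<noteq> 0}"
  shows "evolve M A (\<lambda>c. \<phi> c - \<psi> c) = (\<lambda>c. evolve M A \<phi> c - evolve M A \<psi> c)"
proof
  fix c'
  let ?D = "{c. \<phi> c \<noteq> 0} \<union> {c. \<psi> c \<noteq> 0}"
  have D: "finite ?D" using assms by simp
  have "evolve M A (\<lambda>c. \<phi> c - \<psi> c) c' = (\<Sum>c\<in>?D. (\<phi> c - \<psi> c) * step_amp M A c c')"
    using D by (intro evolve_eq) auto
  also have "\<dots> = evolve M A \<phi> c' - evolve M A \<psi> c'"
    using D by (simp add: evolve_eq[of ?D] left_diff_distrib sum_subtractf)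
  finally show "evolve M A (\<lambda>c. \<phi> c - \<psi> c) c' = evolve M A \<phi> c' - evolve M A \<psi> c'" .
qed

text \<open>Locality of a step: it yields finiteness of supports here and the bound on the query
  track later.\<close>

lemma step_amp_nonzero:
  assumes "step_amp M A c c' \<noteq> 0"
  shows "cstate c = q_query M \<and> c' = oracle_call M A c \<or>
    (\<exists>t\<in>cells M. \<exists>q\<in>states M. \<exists>d. c' = apply_move c t q d)"
proof (cases "cstate c = q_query M")
  case True
  then show ?thesis using assms by (simp add: step_amp_def split: if_splits)
next
  case False
  then have "(\<Sum>(t, q, d) \<in> cells M \<times> states M \<times> UNIV.
      of_bool (c' = apply_move c t q d) * amp M (cstate c) (scanned c) t q d) \<noteq> 0"
    using assms by (simp add: step_amp_def)
  then obtain u where "u \<in> cells M \<times> states M \<times> UNIV"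
      "(case u of (t, q, d) \<Rightarrow> of_bool (c' = apply_move c t q d) *
        amp M (cstate c) (scanned c) t q d) \<noteq> 0"
    by (rule sum.not_neutral_contains_not_neutral)
  then obtain t q d where "t \<in> cells M" "q \<in> states M" "c' = apply_move c t q d"
    by (cases u) (auto split: if_splits)
  then show ?thesis by blast
qed

lemma evolve_nonzero:
  assumes "evolve M A \<psi> c' \<noteq> 0"
  shows "\<exists>c. \<psi> c \<noteq> 0 \<and> step_amp M A c c' \<noteq> 0"
proof (rule ccontr)
  assume "\<not> ?thesis"
  then have "evolve M A \<psi> c' = 0" unfolding evolve_def by (intro sum.neutral) auto
  then show False using assms by simp
qed

lemma finite_dir [simp]: "finite (UNIV :: dir set)"
proof -
  have "UNIV = {MoveL, MoveR}" using dir.exhaust by auto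
  then show ?thesis by (metis finite.simps)
qed

lemma superpositionsD:
  assumes "\<psi> \<in> superpositions M"
  shows "finite {c. \<psi> c \<noteq> 0}" "\<psi> c \<noteq> 0 \<Longrightarrow> c \<in> configs M"
  using assms unfolding superpositions_def by auto

lemma superpositionsI:
  "finite {c. \<psi> c \<noteq> 0} \<Longrightarrow> (\<And>c. \<psi> c \<noteq> 0 \<Longrightarrow> c \<in> configs M) \<Longrightarrow> \<psi> \<in> superpositions M"
  unfolding superpositions_def by auto

lemma evolve_superpositions:
  assumes M: "valid_machine M" and \<psi>: "\<psi> \<in> superpositions M"
  shows "evolve M A \<psi> \<in> superpositions M"
proof -
  let ?R = "\<lambda>c. insert (oracle_call M A c)
      ((\<lambda>(t, q, d). apply_move c t q d) ` (cells M \<times> states M \<times> UNIV))"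
  have sub: "{c'. evolve M A \<psi> c' \<noteq> 0} \<subseteq> (\<Union>c\<in>{c. \<psi> c \<noteq> 0}. ?R c)"
  proof
    fix c' assume "c' \<in> {c'. evolve M A \<psi> c' \<noteq> 0}"
    then obtain c where c: "\<psi> c \<noteq> 0" "step_amp M A c c' \<noteq> 0" using evolve_nonzero by blast
    then have "c' \<in> ?R c" using step_amp_nonzero[OF c(2)] by force
    then show "c' \<in> (\<Union>c\<in>{c. \<psi> c \<noteq> 0}. ?R c)" using c(1) by blast
  qed
  have "finite (cells M)" "finite (states M)"
    using M finite_cells unfolding valid_machine_def by auto
  then have "finite (\<Union>c\<in>{c. \<psi> c \<noteq> 0}. ?R c)"
    using superpositionsD(1)[OF \<psi>] by auto
  then have "finite {c'. evolve M A \<psi> c' \<noteq> 0}" by (rule finite_subset[OF sub])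
  moreover have R: "?R c \<subseteq> configs M" if "\<psi> c \<noteq> 0" for c
    using superpositionsD(2)[OF \<psi> that] oracle_call_configs[OF M] apply_move_configs by auto
  have "c' \<in> configs M" if "evolve M A \<psi> c' \<noteq> 0" for c'
  proof -
    have "c' \<in> (\<Union>c\<in>{c. \<psi> c \<noteq> 0}. ?R c)" using sub that by blast
    then obtain c where c: "\<psi> c \<noteq> 0" "c' \<in> ?R c" by blast
    then show ?thesis using subsetD[OF R[OF c(1)] c(2)] by simp
  qed
  ultimately show ?thesis by (intro superpositionsI)
qed

lemma superpositions_diff:
  assumes "\<phi> \<in> superpositions M" "\<psi> \<in> superpositions M"
  shows "(\<lambda>c. \<phi> c - \<psi> c) \<in> superpositions M"
proof (rule superpositionsI)
  show "finite {c. \<phi> c - \<psi> c \<noteq> 0}"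
    using assms by (intro finite_supp_diff superpositionsD(1))
  show "c \<in> configs M" if "\<phi> c - \<psi> c \<noteq> 0" for c
    using that superpositionsD(2)[OF assms(1), of c] superpositionsD(2)[OF assms(2), of c]
    by (cases "\<phi> c = 0") auto
qed

lemma superpositions_restrict:
  assumes "\<psi> \<in> superpositions M"
  shows "(\<lambda>c. if c \<in> S then \<psi> c else 0) \<in> superpositions M"
proof (rule superpositionsI)
  show "finite {c. (if c \<in> S then \<psi> c else 0) \<noteq> 0}"
    by (rule finite_subset[OF _ superpositionsD(1)[OF assms]]) auto
  show "c \<in> configs M" if "(if c \<in> S then \<psi> c else 0) \<noteq> 0" for c
    using that superpositionsD(2)[OF assms, of c] by (simp split: if_splits)
qed

lemma sq_norm_restrict: "sq_norm (\<lambda>c. if c \<in> S then \<psi> c else 0) = prob S \<psi>"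
  unfolding sq_norm_def prob_def by (intro sum.cong) auto

lemma run_0: "run M A x 0 = (\<lambda>c. of_bool (c = init_config M x))"
  by (simp add: run_def)

lemma run_Suc: "run M A x (Suc k) = evolve M A (run M A x k)"
  by (simp add: run_def)

lemma run_superpositions:
  assumes M: "valid_machine M"
  shows "run M A x k \<in> superpositions M"
proof (induction k)
  case 0
  then show ?case using init_config_configs[OF M] by (simp add: run_0 superpositions_def)
next
  case (Suc k)
  then show ?case using evolve_superpositions[OF M] by (simp add: run_Suc)
qed

lemma vnorm_evolve:
  "well_formed M A \<Longrightarrow> \<psi> \<in> superpositions M \<Longrightarrow> vnorm (evolve M A \<psi>) = vnorm \<psi>"
  by (simp add: well_formed_def vnorm_def)

lemma vnorm_run:
  assumes "valid_machine M" "well_formed M A"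
  shows "vnorm (run M A x k) = 1"
proof (induction k)
  case 0
  show ?case by (simp add: run_0 vnorm_def sq_norm_def)
next
  case (Suc k)
  then show ?case
    using vnorm_evolve[OF assms(2) run_superpositions[OF assms(1)]] by (simp add: run_Suc)
qed

text \<open>Before a query, replacing the oracle \<open>B\<close> by \<open>A\<close> amounts to a permutation of the
  configurations.\<close>

lemma well_formed_oracle:
  assumes M: "valid_machine M" and A: "well_formed M A"
  shows "well_formed M B"
  unfolding well_formed_def
proof
  fix \<psi> assume \<psi>: "\<psi> \<in> superpositions M"
  \<comment> \<open>On a pre-query configuration \<open>P X Y\<close> lets \<open>Y\<close> answer
    and then \<open>X\<close>. Calls being involutions, a call of \<open>A\<close> after
    \<open>P A B\<close> has the effect of a call of \<open>B\<close>, and \<open>P B A\<close>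
    inverts \<open>P A B\<close>.\<close>
  define P where "P X Y c =
      (if cstate c = q_query M then c\<lparr>tape := oracle_tape X (oracle_tape Y (tape c))\<rparr> else c)"
    for X Y and c :: config
  have PP: "P X Y (P Y X c) = c" for X Y c
    by (simp add: P_def oracle_tape_involution)
  \<comment> \<open>This is \<open>\<psi>\<close> transported along \<open>P A B\<close>: each
    configuration receives the amplitude of its preimage.\<close>
  define \<psi>' where "\<psi>' = \<psi> \<circ> P B A"
  have supp: "{c. \<psi>' c \<noteq> 0} = P A B ` {c. \<psi> c \<noteq> 0}"
  proof
    show "{c. \<psi>' c \<noteq> 0} \<subseteq> P A B ` {c. \<psi> c \<noteq> 0}"
      unfolding \<psi>'_def using PP[of A B] by (auto simp: image_iff) metis
  qed (auto simp: \<psi>'_def PP)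
  have inj: "inj_on (P A B) D" for D
    by (rule inj_on_inverseI[of _ "P B A"]) (rule PP)
  have PM: "P A B c \<in> configs M" if "c \<in> configs M" for c
  proof (cases "cstate c = q_query M")
    case True
    have "\<lparr>cstate = q_query M, head = head c, tape = oracle_tape B (tape c)\<rparr> \<in> configs M"
      using that M by (intro configs_tape_update) (auto simp: valid_machine_def)
    from configs_tape_update[OF this, of "q_query M" "head c" A]
    have "\<lparr>cstate = q_query M, head = head c, tape = oracle_tape A (oracle_tape B (tape c))\<rparr> \<in> configs M"
      using M by (auto simp: valid_machine_def)
    moreover have "P A B c = \<lparr>cstate = q_query M, head = head c, tape = oracle_tape A (oracle_tape B (tape c))\<rparr>"
      using True by (simp add: P_def)
    ultimately show ?thesis by simp
  next
    case False
    then show ?thesis using that by (simp add: P_def)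
  qed
  have \<psi>': "\<psi>' \<in> superpositions M"
  proof (rule superpositionsI)
    show "finite {c. \<psi>' c \<noteq> 0}"
      unfolding supp using superpositionsD(1)[OF \<psi>] by simp
    show "c \<in> configs M" if "\<psi>' c \<noteq> 0" for c
    proof -
      have "c \<in> P A B ` {c. \<psi> c \<noteq> 0}" using that supp by blast
      then show ?thesis using PM superpositionsD(2)[OF \<psi>] by blast
    qed
  qed
  have step: "step_amp M B c = step_amp M A (P A B c)" for c
    by (simp add: step_amp_def P_def oracle_call_def oracle_tape_involution fun_eq_iff)
  have "evolve M B \<psi> = evolve M A \<psi>'"
  proof
    fix c'
    have "evolve M A \<psi>' c' = (\<Sum>c\<in>{c. \<psi> c \<noteq> 0}. \<psi>' (P A B c) * step_amp M A (P A B c) c')"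
      unfolding evolve_def supp by (simp add: sum.reindex[OF inj])
    then show "evolve M B \<psi> c' = evolve M A \<psi>' c'"
      by (simp add: evolve_def step \<psi>'_def PP)
  qed
  moreover have "sq_norm \<psi>' = sq_norm \<psi>"
    unfolding sq_norm_def supp by (simp add: sum.reindex[OF inj] \<psi>'_def PP)
  ultimately show "sq_norm (evolve M B \<psi>) = sq_norm \<psi>"
    using A \<psi>' unfolding well_formed_def by simp
qed

section \<open>Perturbing the oracle by one word\<close>

text \<open>Split \<open>\<psi>\<close> into the part \<open>w\<close> that asks about
  \<open>x\<close> and the rest \<open>r\<close>. Both oracles act alike on \<open>r\<close>, and
  each preserves the norm of \<open>w\<close>, so the distance is at most twice that norm.\<close>

lemma oracle_insert_distance:
  assumes M: "valid_machine M" and wf: "\<And>A. well_formed M A" and \<psi>: "\<psi> \<in> superpositions M"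
  shows "vnorm (\<lambda>c. evolve M (insert x F) \<psi> c - evolve M F \<psi> c) \<le> 2 * sqrt (prob (querying M x) \<psi>)"
proof -
  define w where "w c = (if c \<in> querying M x then \<psi> c else 0)" for c
  define r where "r c = (if c \<in> - querying M x then \<psi> c else 0)" for c
  have w: "w \<in> superpositions M" and r: "r \<in> superpositions M"
    using superpositions_restrict[OF \<psi>] unfolding w_def r_def by blast+
  note fin = superpositionsD(1)
  have \<psi>w: "\<psi> c - w c = r c" for c by (simp add: w_def r_def)
  have "step_amp M (insert x F) c c' = step_amp M F c c'" if "r c \<noteq> 0" for c c'
  proof -
    have "c \<notin> querying M x" using that by (auto simp: r_def)
    then show ?thesis by (simp add: step_amp_def oracle_call_insert)
  qed
  then have "evolve M (insert x F) r = evolve M F r"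
    unfolding evolve_def by (intro ext sum.cong) auto
  then have "evolve M (insert x F) \<psi> c - evolve M F \<psi> c = evolve M (insert x F) w c - evolve M F w c" for c
    using evolve_diff[OF fin[OF \<psi>] fin[OF w], of M] unfolding \<psi>w
    by (simp add: fun_eq_iff diff_eq_eq)
  then have "vnorm (\<lambda>c. evolve M (insert x F) \<psi> c - evolve M F \<psi> c) =
      vnorm (\<lambda>c. evolve M (insert x F) w c - evolve M F w c)" by simp
  also have "\<dots> \<le> vnorm (evolve M (insert x F) w) + vnorm (evolve M F w)"
    by (intro vnorm_diff fin[OF evolve_superpositions[OF M w]])
  also have "\<dots> = 2 * vnorm w" using vnorm_evolve[OF wf w] by simp
  also have "vnorm w = sqrt (prob (querying M x) \<psi>)"
    unfolding vnorm_def w_def sq_norm_restrict ..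
  finally show ?thesis .
qed

text \<open>Errors add up over time but do not grow, since evolution preserves norms. All query
  weights are taken in the run with oracle \<open>F\<close>, which does not depend on
  \<open>x\<close>; this makes the counting of heavy words possible.\<close>

lemma hybrid:
  assumes M: "valid_machine M" and wf: "\<And>A. well_formed M A"
  shows "vnorm (\<lambda>c. run M (insert x F) y k c - run M F y k c) \<le>
    2 * (\<Sum>t<k. sqrt (prob (querying M x) (run M F y t)))"
proof (induction k)
  case 0
  show ?case by (simp add: run_0 vnorm_def sq_norm_def)
next
  case (Suc k)
  define \<phi> where "\<phi> = run M (insert x F) y k"
  define \<psi> where "\<psi> = run M F y k"
  have sp: "\<phi> \<in> superpositions M" "\<psi> \<in> superpositions M"
    unfolding \<phi>_def \<psi>_def by (rule run_superpositions[OF M])+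
  note fin = superpositionsD(1)
  let ?U = "evolve M (insert x F)"
  \<comment> \<open>Compare both sides with \<open>?U \<psi>\<close>: one difference is the old
    error evolved, the other is the error of the present step.\<close>
  have "vnorm (\<lambda>c. ?U \<phi> c - evolve M F \<psi> c) =
      vnorm (\<lambda>c. ?U (\<lambda>c. \<phi> c - \<psi> c) c + (?U \<psi> c - evolve M F \<psi> c))"
    using evolve_diff[OF fin[OF sp(1)] fin[OF sp(2)]] by simp
  also have "\<dots> \<le> vnorm (?U (\<lambda>c. \<phi> c - \<psi> c)) + vnorm (\<lambda>c. ?U \<psi> c - evolve M F \<psi> c)"
    by (intro vnorm_add fin[OF evolve_superpositions[OF M superpositions_diff[OF sp]]]
        finite_supp_diff fin[OF evolve_superpositions[OF M sp(2)]])
  also have "vnorm (?U (\<lambda>c. \<phi> c - \<psi> c)) = vnorm (\<lambda>c. \<phi> c - \<psi> c)"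
    by (intro vnorm_evolve wf superpositions_diff sp)
  also have "\<dots> \<le> 2 * (\<Sum>t<k. sqrt (prob (querying M x) (run M F y t)))"
    using Suc unfolding \<phi>_def \<psi>_def .
  also have "vnorm (\<lambda>c. ?U \<psi> c - evolve M F \<psi> c) \<le> 2 * sqrt (prob (querying M x) \<psi>)"
    by (rule oracle_insert_distance[OF M wf sp(2)])
  finally show ?case
    unfolding run_Suc \<phi>_def[symmetric] \<psi>_def[symmetric] by (simp add: \<psi>_def algebra_simps)
qed

section \<open>Counting heavily queried words\<close>

lemma sum_prob_querying:
  assumes "finite {c. \<psi> c \<noteq> 0}" "finite X"
  shows "(\<Sum>x\<in>X. prob (querying M x) \<psi>) \<le> sq_norm \<psi>"
proof -
  have "(\<Sum>x\<in>X. prob (querying M x) \<psi>) =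
      (\<Sum>c\<in>(\<Union>x\<in>X. {c. \<psi> c \<noteq> 0 \<and> c \<in> querying M x}). (cmod (\<psi> c))\<^sup>2)"
    unfolding prob_def
  proof (rule sum.UNION_disjoint[symmetric])
    show "\<forall>x\<in>X. \<forall>y\<in>X. x \<noteq> y \<longrightarrow>
      {c. \<psi> c \<noteq> 0 \<and> c \<in> querying M x} \<inter> {c. \<psi> c \<noteq> 0 \<and> c \<in> querying M y} = {}"
      using querying_disjoint[of _ _ M] by blast
  qed (use assms in auto)
  also have "\<dots> \<le> sq_norm \<psi>"
    unfolding sq_norm_def using assms(1) by (intro sum_mono2) auto
  finally show ?thesis .
qed

text \<open>A Markov bound: a configuration asks about at most one word, so the masses, each at
  least \<open>\<delta>\<^sup>2\<close>, add up to at most 1.\<close>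

lemma card_heavy_queries:
  assumes "finite {c. \<psi> c \<noteq> 0}" "vnorm \<psi> = 1" "finite X" "0 < \<delta>"
    and "\<And>x. x \<in> X \<Longrightarrow> \<delta> \<le> sqrt (prob (querying M x) \<psi>)"
  shows "real (card X) * \<delta>\<^sup>2 \<le> 1"
proof -
  have "\<delta>\<^sup>2 \<le> prob (querying M x) \<psi>" if "x \<in> X" for x
    using assms(4) power_mono[OF assms(5)[OF that], of 2] prob_nonneg by simp
  then have "real (card X) * \<delta>\<^sup>2 \<le> (\<Sum>x\<in>X. prob (querying M x) \<psi>)"
    using sum_bounded_below[of X "\<delta>\<^sup>2"] by simp
  also have "\<dots> \<le> sq_norm \<psi>" by (rule sum_prob_querying[OF assms(1,3)])
  finally show ?thesis using assms(2) by (simp add: vnorm_def)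
qed

section \<open>Words that a machine can spell out\<close>

definition unit_word :: "nat \<Rightarrow> nat \<Rightarrow> bool list" where
  "unit_word n i = (replicate n False)[i := True]"

text \<open>A decider for \<open>hit_lang A\<close> behaves this way if \<open>x\<close> is the only
  word of its length in \<open>A\<close> and \<open>T\<close> bounds the halting times on the unit
  words.\<close>

definition reveals :: "qtm \<Rightarrow> bool list set \<Rightarrow> nat \<Rightarrow> bool list \<Rightarrow> bool" where
  "reveals M A T x \<longleftrightarrow> (\<forall>i<length x. \<exists>k\<le>T. halts_at M A (unit_word (length x) i) k \<and>
     (if x ! i then accept_prob M A (unit_word (length x) i) k \<ge> 2/3
      else accept_prob M A (unit_word (length x) i) k \<le> 1/3))"

lemma accept_prob_prob:
  "accept_prob M A y k = prob {c. ans (tape c 0) = Some True} (run M A y k)"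
  by (simp add: accept_prob_def prob_def)

text \<open>Halting becomes an event of probability 1, and by the next lemma 0 at earlier times, so
  closeness of two runs also compares their halting times.\<close>

lemma halts_at_prob:
  assumes "halts_at M A y k" "vnorm (run M A y k) = 1"
  shows "prob {c. cstate c = q_final M} (run M A y k) = 1"
proof -
  have "prob {c. cstate c = q_final M} (run M A y k) = sq_norm (run M A y k)"
    using assms(1) unfolding prob_def sq_norm_def halts_at_def by (intro sum.cong) auto
  then show ?thesis using assms(2) by (simp add: vnorm_def)
qed

lemma not_halted_prob:
  assumes "halts_at M A y k" "j < k"
  shows "prob {c. cstate c = q_final M} (run M A y j) = 0"
proof -
  have "{c. run M A y j c \<noteq> 0 \<and> c \<in> {c. cstate c = q_final M}} = {}"
    using assms unfolding halts_at_def by blast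
  then show ?thesis unfolding prob_def by (metis sum.empty)
qed

text \<open>Each of the two runs is within \<open>2/25\<close> of the run with oracle \<open>F\<close>.  So the probabilities of any
  event differ by at most \<open>8/25 < 1/3\<close>, which forces equal halting times and equal bits.\<close>

lemma reveals_light_unique:
  assumes M: "valid_machine M" and wf: "\<And>A. well_formed M A"
    and len: "length x = n" "length x' = n"
    and rev: "reveals M (insert x F) T x" "reveals M (insert x' F) T x'"
    and light: "\<And>i t. i < n \<Longrightarrow> t < T \<Longrightarrow>
        sqrt (prob (querying M x) (run M F (unit_word n i) t)) \<le> 1 / (25 * real (T + 1))"
      "\<And>i t. i < n \<Longrightarrow> t < T \<Longrightarrow>
        sqrt (prob (querying M x') (run M F (unit_word n i) t)) \<le> 1 / (25 * real (T + 1))"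
  shows "x = x'"
proof (rule nth_equalityI)
  show "length x = length x'" using len by simp
next
  fix i assume "i < length x"
  then have i: "i < n" using len by simp
  define y where "y = unit_word n i"
  define \<phi> where "\<phi> k = run M (insert x F) y k" for k
  define \<phi>' where "\<phi>' k = run M (insert x' F) y k" for k
  define \<psi> where "\<psi> k = run M F y k" for k
  have sp: "\<phi> k \<in> superpositions M" "\<phi>' k \<in> superpositions M" "\<psi> k \<in> superpositions M" for k
    unfolding \<phi>_def \<phi>'_def \<psi>_def by (rule run_superpositions[OF M])+
  have norm1: "vnorm (\<phi> k) = 1" "vnorm (\<phi>' k) = 1" for k
    unfolding \<phi>_def \<phi>'_def by (rule vnorm_run[OF M wf])+
  have small: "2 * (\<Sum>t<k. f t) \<le> 2 / 25"
    if "k \<le> T" "\<And>t. t < T \<Longrightarrow> f t \<le> 1 / (25 * real (T + 1))" for k and f :: "nat \<Rightarrow> real"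
  proof -
    have "(\<Sum>t<k. f t) \<le> (\<Sum>t<k. 1 / (25 * real (T + 1)))" using that by (intro sum_mono) auto
    also have "\<dots> = real k / (25 * real (T + 1))" by simp
    also have "\<dots> \<le> 1 / 25" using that(1) by (simp add: field_simps)
    finally show ?thesis by simp
  qed
  have near: "\<bar>prob S (\<phi> k) - prob S (\<phi>' k)\<bar> < 1 / 3" if "k \<le> T" for k S
  proof -
    have d: "vnorm (\<lambda>c. \<phi> k c - \<psi> k c) \<le> 2 / 25" "vnorm (\<lambda>c. \<phi>' k c - \<psi> k c) \<le> 2 / 25"
      using order_trans[OF hybrid[OF M wf] small[OF that]] light[OF i]
      unfolding \<phi>_def \<phi>'_def \<psi>_def y_def by blast+
    have "vnorm (\<lambda>c. \<phi> k c - \<phi>' k c) = vnorm (\<lambda>c. (\<phi> k c - \<psi> k c) + (\<psi> k c - \<phi>' k c))" by simp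
    also have "\<dots> \<le> vnorm (\<lambda>c. \<phi> k c - \<psi> k c) + vnorm (\<lambda>c. \<psi> k c - \<phi>' k c)"
      by (intro vnorm_add finite_supp_diff superpositionsD(1)[OF sp(1)]
          superpositionsD(1)[OF sp(2)] superpositionsD(1)[OF sp(3)])
    also have "\<dots> \<le> 4 / 25" using d vnorm_minus_swap[of "\<phi>' k" "\<psi> k"] by simp
    finally show ?thesis
      using prob_diff[OF superpositionsD(1)[OF sp(1)] superpositionsD(1)[OF sp(2)] norm1, of S k k]
      by simp
  qed
  have "i < length x" "i < length x'" using i len by auto
  obtain k where k: "k \<le> T" "halts_at M (insert x F) y k"
    "if x ! i then accept_prob M (insert x F) y k \<ge> 2/3 else accept_prob M (insert x F) y k \<le> 1/3"
    using rev(1)[unfolded reveals_def, rule_format, OF \<open>i < length x\<close>]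
    unfolding len y_def[symmetric] by (elim exE conjE)
  obtain k' where k': "k' \<le> T" "halts_at M (insert x' F) y k'"
    "if x' ! i then accept_prob M (insert x' F) y k' \<ge> 2/3 else accept_prob M (insert x' F) y k' \<le> 1/3"
    using rev(2)[unfolded reveals_def, rule_format, OF \<open>i < length x'\<close>]
    unfolding len y_def[symmetric] by (elim exE conjE)
  let ?Fin = "{c. cstate c = q_final M}"
  \<comment> \<open>At time \<open>k\<close> the event \<open>?Fin\<close> would have probability 1
    in one run and 0 in the other.\<close>
  have "\<not> k < k'"
  proof
    assume "k < k'"
    then have "prob ?Fin (\<phi> k) = 1" "prob ?Fin (\<phi>' k) = 0"
      using halts_at_prob[OF k(2)] norm1(1)[of k] not_halted_prob[OF k'(2)] unfolding \<phi>_def \<phi>'_def by auto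
    then show False using near[OF k(1), of ?Fin] by simp
  qed
  moreover have "\<not> k' < k"
  proof
    assume "k' < k"
    then have "prob ?Fin (\<phi>' k') = 1" "prob ?Fin (\<phi> k') = 0"
      using halts_at_prob[OF k'(2)] norm1(2)[of k'] not_halted_prob[OF k(2)] unfolding \<phi>_def \<phi>'_def by auto
    then show False using near[OF k'(1), of ?Fin] by simp
  qed
  ultimately have kk: "k' = k" by simp
  \<comment> \<open>Different bits would make the acceptance probabilities at the common halting
    time differ by at least \<open>1/3\<close>.\<close>
  show "x ! i = x' ! i"
    using k(3) k'(3) near[OF k(1), of "{c. ans (tape c 0) = Some True}"]
    unfolding kk accept_prob_prob \<phi>_def[symmetric] \<phi>'_def[symmetric]
    by (auto split: if_splits)
qed

text \<open>At most one such word is light at all indices and times, and each of the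
  \<open>n * T\<close> pairs of index and time has at most \<open>1 / \<delta>\<^sup>2\<close> heavy
  words.\<close>

lemma card_reveals:
  assumes M: "valid_machine M" and wf: "\<And>A. well_formed M A"
  shows "card {x. length x = n \<and> reveals M (insert x F) T x} \<le> 1 + n * (625 * (T + 1)^3)"
proof -
  define \<delta> where "\<delta> = 1 / (25 * real (T + 1))"
  have "\<delta> > 0" unfolding \<delta>_def by simp
  define Heavy where "Heavy = (\<lambda>(i, t).
      {x. length x = n \<and> \<delta> \<le> sqrt (prob (querying M x) (run M F (unit_word n i) t))})"
  define L where "L = {x. length x = n \<and> reveals M (insert x F) T x} - (\<Union>u\<in>{..<n} \<times> {..<T}. Heavy u)"
  have fin_n: "finite {x :: bool list. length x = n}"
    using finite_lists_length_eq[of "UNIV :: bool set" n] by simp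
  have fH: "finite (Heavy u)" for u
    by (rule finite_subset[OF _ fin_n]) (auto simp: Heavy_def split: prod.splits)
  have cH: "card (Heavy u) \<le> 625 * (T + 1)\<^sup>2" for u
  proof -
    obtain i t where u: "u = (i, t)" by (cases u)
    have "real (card (Heavy u)) * \<delta>\<^sup>2 \<le> 1"
      using fH[of u] \<open>\<delta> > 0\<close>
      by (intro card_heavy_queries[where M = M and \<psi> = "run M F (unit_word n i) t"]
          superpositionsD(1)[OF run_superpositions[OF M]] vnorm_run[OF M wf])
        (auto simp: Heavy_def u)
    moreover have "1 / \<delta>\<^sup>2 = real (625 * (T + 1)\<^sup>2)"
    proof -
      have "1 / \<delta>\<^sup>2 = (25 * real (T + 1))\<^sup>2" unfolding \<delta>_def by (simp only: power_one_over) simp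
      also have "\<dots> = 25\<^sup>2 * (real (T + 1))\<^sup>2" by (rule power_mult_distrib)
      finally show ?thesis by simp
    qed
    ultimately have "real (card (Heavy u)) \<le> real (625 * (T + 1)\<^sup>2)"
      using \<open>\<delta> > 0\<close> by (metis pos_le_divide_eq zero_less_power)
    then show ?thesis by (simp only: of_nat_le_iff)
  qed
  have "x = x'" if "x \<in> L" "x' \<in> L" for x x'
  proof (rule reveals_light_unique[OF M wf, of x n x' F T])
    show "sqrt (prob (querying M x) (run M F (unit_word n i) t)) \<le> 1 / (25 * real (T + 1))"
      if "i < n" "t < T" for i t
      using \<open>x \<in> L\<close> that unfolding L_def Heavy_def \<delta>_def[symmetric] by force
    show "sqrt (prob (querying M x') (run M F (unit_word n i) t)) \<le> 1 / (25 * real (T + 1))"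
      if "i < n" "t < T" for i t
      using \<open>x' \<in> L\<close> that unfolding L_def Heavy_def \<delta>_def[symmetric] by force
  qed (use that in \<open>auto simp: L_def\<close>)
  moreover have "finite L" by (rule finite_subset[OF _ fin_n]) (auto simp: L_def)
  ultimately have cL: "card L \<le> 1" "finite L"
    using card_le_Suc0_iff_eq[of L] by auto
  let ?U = "\<Union>u\<in>{..<n} \<times> {..<T}. Heavy u"
  have "{x. length x = n \<and> reveals M (insert x F) T x} \<subseteq> L \<union> ?U" unfolding L_def by blast
  then have "card {x. length x = n \<and> reveals M (insert x F) T x} \<le> card (L \<union> ?U)"
    using cL(2) fH by (intro card_mono) auto
  also have "\<dots> \<le> card L + card ?U" by (rule card_Un_le)
  also have "card ?U \<le> (\<Sum>u\<in>{..<n} \<times> {..<T}. card (Heavy u))" by (rule card_UN_le) simp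
  also have "\<dots> \<le> (\<Sum>u\<in>{..<n} \<times> {..<T}. 625 * (T + 1)\<^sup>2)" by (intro sum_mono cH)
  also have "\<dots> = n * (T * (625 * (T + 1)\<^sup>2))" by simp
  \<comment> \<open>One factor \<open>T\<close> is rounded up to merge the factors into a
    cube.\<close>
  also have "\<dots> \<le> n * ((T + 1) * (625 * (T + 1)\<^sup>2))" by (intro mult_le_mono) auto
  also have "\<dots> = n * (625 * (T + 1)^3)"
    by (simp only: power3_eq_cube power2_eq_square ac_simps)
  finally show ?thesis using cL(1) by simp
qed

section \<open>Short runs cannot query long words\<close>

text \<open>A move writes one cell and an oracle call leaves the set of non-blank query cells
  unchanged, so each step adds at most one such cell.\<close>

lemma run_query_track:
  assumes "run M A y k c \<noteq> 0"
  shows "finite {p. query (tape c p) \<noteq> None} \<and> card {p. query (tape c p) \<noteq> None} \<le> k"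
  using assms
proof (induction k arbitrary: c)
  case 0
  then have "{p. query (tape c p) \<noteq> None} = {}"
    by (auto simp: run_0 init_config_def blank_cell_def)
  then show ?case by simp
next
  case (Suc k)
  then obtain c0 where c0: "run M A y k c0 \<noteq> 0" "step_amp M A c0 c \<noteq> 0"
    using evolve_nonzero unfolding run_Suc by blast
  have "{p. query (tape c p) \<noteq> None} \<subseteq> insert (head c0) {p. query (tape c0 p) \<noteq> None}"
  proof
    fix p assume p: "p \<in> {p. query (tape c p) \<noteq> None}"
    from step_amp_nonzero[OF c0(2)] show "p \<in> insert (head c0) {p. query (tape c0 p) \<noteq> None}"
    proof (elim disjE conjE bexE exE)
      assume "c = oracle_call M A c0"
      then show ?thesis using p oracle_tape_None_iff[of A "tape c0" p] by (simp add: oracle_call_def)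
    qed (use p in \<open>simp add: apply_move_def split: if_splits\<close>)
  qed
  moreover have "finite (insert (head c0) {p. query (tape c0 p) \<noteq> None})"
    "card (insert (head c0) {p. query (tape c0 p) \<noteq> None}) \<le> Suc k"
    using Suc.IH[OF c0(1)] by (auto simp: card_insert_if)
  ultimately show ?case by (meson card_mono finite_subset order_trans)
qed

text \<open>The inequality is strict because the target bit occupies a cell besides those of
  \<open>x\<close>.\<close>

lemma querying_length:
  assumes "run M A y k c \<noteq> 0" "query_block (tape c) i (x @ [b])"
  shows "length x < k"
proof -
  have "{p. query (tape c p) \<noteq> None} = {i..<i + int (length (x @ [b]))}"
    using query_block_in[OF assms(2)] by auto
  then have "card {p. query (tape c p) \<noteq> None} = length (x @ [b])" by simp
  then show ?thesis using run_query_track[OF assms(1)] by simp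
qed

lemma run_oracle_cong:
  assumes "\<And>x. length x < T \<Longrightarrow> x \<in> A \<longleftrightarrow> x \<in> B" "k \<le> T"
  shows "run M A y k = run M B y k"
  using assms(2)
proof (induction k)
  case 0
  show ?case by (simp add: run_0)
next
  case (Suc k)
  have "step_amp M A c = step_amp M B c" if "run M A y k c \<noteq> 0" for c
  proof -
    have "oracle_tape A (tape c) = oracle_tape B (tape c)"
      using querying_length[OF that] assms(1) Suc.prems by (intro oracle_tape_cong) fastforce
    then show ?thesis by (intro ext) (simp add: step_amp_def oracle_call_def)
  qed
  then have "evolve M A (run M A y k) = evolve M B (run M A y k)"
    unfolding evolve_def by (intro ext sum.cong) auto
  then show ?case using Suc by (simp add: run_Suc)
qed

lemma reveals_oracle_cong:
  assumes "\<And>w. length w < T \<Longrightarrow> w \<in> A \<longleftrightarrow> w \<in> B" "reveals M A T x"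
  shows "reveals M B T x"
proof -
  have "run M A y k = run M B y k" if "k \<le> T" for k y
    using run_oracle_cong[OF assms(1) that] by blast
  then have "halts_at M A y k = halts_at M B y k" "accept_prob M A y k = accept_prob M B y k"
    if "k \<le> T" for k y
    using that by (auto simp: halts_at_def accept_prob_def)
  then show ?thesis using assms(2) unfolding reveals_def by metis
qed

section \<open>A search problem in NP\<close>

text \<open>The bound is the length of \<open>w\<close>, so the predicate also applies to a partial
  guess \<open>w\<close> written along a longer input \<open>y\<close>.\<close>

definition hit :: "bool list \<Rightarrow> bool list \<Rightarrow> bool" where
  "hit y w \<longleftrightarrow> (\<exists>i<length w. w ! i \<and> y ! i)"

definition hit_lang :: "bool list set \<Rightarrow> bool list set" where
  "hit_lang A = {y. \<exists>x\<in>A. length x = length y \<and> hit y x}"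

text \<open>States 0 and 1 guess a query word along the input; state 1 records that the guess has hit the
  input.  State 4 reads the answer, which the oracle call leaves in the cell after the guess.\<close>

definition hit_machine :: ntm where
  "hit_machine = \<lparr>states = {..5}, alph = {Blank, Bit False, Bit True},
     q_init = 0, q_final = 5, q_query = 2, q_answer = 3,
     delta = (\<lambda>q s.
       if q = 0 \<or> q = 1 then
         (case work s of
           Bit b \<Rightarrow> {(s\<lparr>query := Some g\<rparr>, of_bool (q = 1 \<or> g \<and> b), MoveR) | g. True}
         | Blank \<Rightarrow> if q = 1 then {(s\<lparr>query := Some False\<rparr>, 2, MoveL)} else {}
         | Aux _ \<Rightarrow> {})
       else if q = 3 then {(s, 4, MoveR)}
       else if q = 4 \<and> query s = Some True then {(s, 5, MoveR)}
       else {})\<rparr>"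

lemma q_final_hit_machine [simp]: "q_final hit_machine = 5"
  by (simp add: hit_machine_def)

lemma valid_hit_machine: "valid_ntm hit_machine"
  unfolding valid_ntm_def
proof (intro conjI ballI)
  show "valid_machine hit_machine" by (auto simp: valid_machine_def hit_machine_def)
  fix q s assume "q \<in> states hit_machine" "s \<in> cells hit_machine"
  then show "delta hit_machine q s \<subseteq> cells hit_machine \<times> states hit_machine \<times> UNIV"
    by (auto simp: hit_machine_def cells_def split: sym.splits if_splits)
qed

definition track_tape :: "bool list \<Rightarrow> bool list \<Rightarrow> int \<Rightarrow> cell" where
  "track_tape y v = (\<lambda>p. \<lparr>work = if 0 \<le> p \<and> p < int (length y) then Bit (y ! nat p) else Blank,
     query = if 0 \<le> p \<and> p < int (length v) then Some (v ! nat p) else None, ans = None\<rparr>)"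

definition guess_config :: "bool list \<Rightarrow> bool list \<Rightarrow> config" where
  "guess_config y w = \<lparr>cstate = of_bool (hit y w), head = int (length w), tape = track_tape y w\<rparr>"

lemma init_guess_config: "init_config hit_machine y = guess_config y []"
proof -
  have "(\<lambda>p. if 0 \<le> p \<and> p < int (length y) then blank_cell\<lparr>work := Bit (y ! nat p)\<rparr> else blank_cell) =
      track_tape y []"
    by (rule ext) (simp add: track_tape_def blank_cell_def)
  then show ?thesis by (simp add: init_config_def guess_config_def hit_machine_def hit_def)
qed

lemma track_tape_append:
  "(track_tape y w)(int (length w) := (track_tape y w (int (length w)))\<lparr>query := Some g\<rparr>) =
   track_tape y (w @ [g])" (is "?l = ?r")
proof
  fix p
  show "?l p = ?r p"
  proof (cases "p = int (length w)")
    case True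
    have "(track_tape y w (int (length w)))\<lparr>query := Some g\<rparr> = ?r (int (length w))"
      by (simp add: track_tape_def)
    then show ?thesis unfolding True by (simp only: fun_upd_same)
  next
    case False
    have 1: "p < int (length (w @ [g])) \<longleftrightarrow> p < int (length w)" using False by simp linarith
    have 2: "0 \<le> p \<Longrightarrow> p < int (length w) \<Longrightarrow> (w @ [g]) ! nat p = w ! nat p"
      by (simp add: nth_append nat_less_iff)
    have "track_tape y w p = ?r p" unfolding track_tape_def 1 using 2 by (simp cong: if_cong)
    then show ?thesis using False by (simp only: fun_upd_other not_False_eq_True)
  qed
qed

lemma hit_append: "hit y (w @ [g]) \<longleftrightarrow> hit y w \<or> g \<and> y ! length w"
  by (simp add: hit_def Ex_less_Suc nth_append disj_commute cong: conj_cong)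

lemma nstep_guess:
  assumes "length w < length y"
  shows "nstep hit_machine A (guess_config y w) c \<longleftrightarrow> (\<exists>g. c = guess_config y (w @ [g]))"
proof -
  let ?s = "track_tape y w (int (length w))"
  have s: "scanned (guess_config y w) = ?s" by (simp add: scanned_def guess_config_def)
  have "work ?s = Bit (y ! length w)" using assms by (simp add: track_tape_def)
  then have d: "delta hit_machine (cstate (guess_config y w)) ?s =
      {(?s\<lparr>query := Some g\<rparr>, of_bool (hit y (w @ [g])), MoveR) | g. True}"
    using assms by (auto simp: hit_machine_def guess_config_def hit_append)
  have m: "apply_move (guess_config y w) (?s\<lparr>query := Some g\<rparr>) (of_bool (hit y (w @ [g]))) MoveR =
      guess_config y (w @ [g])" for g
    by (simp add: apply_move_def guess_config_def track_tape_append)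
  have "cstate (guess_config y w) \<le> 1" by (simp add: guess_config_def)
  then have "cstate (guess_config y w) \<noteq> q_final hit_machine"
    "cstate (guess_config y w) \<noteq> q_query hit_machine"
    by (auto simp: hit_machine_def)
  moreover have "(\<exists>(s', q, d) \<in> delta hit_machine (cstate (guess_config y w)) ?s.
      c = apply_move (guess_config y w) s' q d) \<longleftrightarrow> (\<exists>g. c = guess_config y (w @ [g]))"
    unfolding d m[symmetric] by blast
  ultimately show ?thesis
    unfolding nstep_def s by simp
qed

lemma nstep_query:
  assumes "length w = length y"
  shows "nstep hit_machine A (guess_config y w) c \<longleftrightarrow> hit y w \<and>
    c = \<lparr>cstate = 2, head = int (length w) - 1, tape = track_tape y (w @ [False])\<rparr>"
proof -
  let ?s = "track_tape y w (int (length w))"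
  have s: "scanned (guess_config y w) = ?s" by (simp add: scanned_def guess_config_def)
  have "work ?s = Blank" using assms by (simp add: track_tape_def)
  then have d: "delta hit_machine (cstate (guess_config y w)) ?s =
      (if hit y w then {(?s\<lparr>query := Some False\<rparr>, 2, MoveL)} else {})"
    by (auto simp: hit_machine_def guess_config_def)
  have m: "apply_move (guess_config y w) (?s\<lparr>query := Some False\<rparr>) 2 MoveL =
      \<lparr>cstate = 2, head = int (length w) - 1, tape = track_tape y (w @ [False])\<rparr>"
    by (simp add: apply_move_def guess_config_def track_tape_append)
  have "cstate (guess_config y w) \<le> 1" by (simp add: guess_config_def)
  then have "cstate (guess_config y w) \<noteq> q_final hit_machine"
    "cstate (guess_config y w) \<noteq> q_query hit_machine"
    by (auto simp: hit_machine_def)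
  then show ?thesis
    unfolding nstep_def s d by (auto simp: m)
qed

lemma query_block_track_tape: "query_block (track_tape y v) 0 v"
  by (simp add: query_block_def track_tape_def)

lemma oracle_track_tape: "oracle_tape A (track_tape y (w @ [False])) = track_tape y (w @ [w \<in> A])"
proof -
  have "(track_tape y (w @ [False]))(int (length w) :=
      (track_tape y (w @ [False]) (int (length w)))\<lparr>query := Some True\<rparr>) = track_tape y (w @ [True])"
    unfolding track_tape_append[symmetric] by simp
  then show ?thesis by (simp add: oracle_tape_block[OF query_block_track_tape])
qed

lemma nstep_answer:
  "nstep hit_machine A \<lparr>cstate = 2, head = h, tape = track_tape y (w @ [False])\<rparr> c \<longleftrightarrow>
    c = \<lparr>cstate = 3, head = h, tape = track_tape y (w @ [w \<in> A])\<rparr>"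
  by (simp add: nstep_def oracle_call_def oracle_track_tape) (simp add: hit_machine_def)

lemma nstep_return:
  "nstep hit_machine A \<lparr>cstate = 3, head = h, tape = t\<rparr> c \<longleftrightarrow> c = \<lparr>cstate = 4, head = h + 1, tape = t\<rparr>"
  by (simp add: nstep_def hit_machine_def apply_move_def scanned_def)

lemma nstep_check:
  "nstep hit_machine A \<lparr>cstate = 4, head = h, tape = t\<rparr> c \<longleftrightarrow>
    query (t h) = Some True \<and> c = \<lparr>cstate = 5, head = h + 1, tape = t\<rparr>"
  by (simp add: nstep_def hit_machine_def apply_move_def scanned_def)

lemma nstep_final: "\<not> nstep hit_machine A \<lparr>cstate = 5, head = h, tape = t\<rparr> c"
  by (simp add: nstep_def hit_machine_def)

lemma query_track_tape_last: "query (track_tape y (w @ [b]) (int (length w))) = Some b"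
  by (simp add: track_tape_def)

text \<open>The phases after guessing, indexed by the state \<open>j\<close>. Every move shifts the
  head, so it steps left off the target cell before the call and returns to it in state 4. The
  target bit is 0 in state 2 and holds the answer afterwards.\<close>

definition verify_config :: "bool list set \<Rightarrow> bool list \<Rightarrow> bool list \<Rightarrow> nat \<Rightarrow> config" where
  "verify_config A y w j =
    \<lparr>cstate = j, head = int (length w) + (if j < 4 then - 1 else if j = 4 then 0 else 1),
     tape = track_tape y (w @ [j \<noteq> 2 \<and> w \<in> A])\<rparr>"

text \<open>An invariant that ties each reachable configuration to its time, so that it yields both
  the time bound and the soundness of acceptance.\<close>

lemma hit_machine_reach:
  assumes "(nstep hit_machine A ^^ k) (init_config hit_machine y) c"
  shows "(\<exists>w. length w = k \<and> k \<le> length y \<and> c = guess_config y w) \<or>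
    (\<exists>w j. length w = length y \<and> hit y w \<and> 2 \<le> j \<and> j \<le> 5 \<and> k + 1 = length y + j \<and>
       (j = 5 \<longrightarrow> w \<in> A) \<and> c = verify_config A y w j)"
  using assms
proof (induction k arbitrary: c)
  case 0
  then show ?case by (simp add: init_guess_config)
next
  case (Suc k)
  then obtain c0 where c0: "(nstep hit_machine A ^^ k) (init_config hit_machine y) c0"
    "nstep hit_machine A c0 c" by auto
  from Suc.IH[OF c0(1)] show ?case
  proof (elim disjE exE conjE)
    fix w assume w: "length w = k" "k \<le> length y" "c0 = guess_config y w"
    show ?thesis
    proof (cases "k < length y")
      case True
      then have "length w < length y" using w(1) by simp
      then obtain g where "c = guess_config y (w @ [g])"
        using iffD1[OF nstep_guess c0(2)[unfolded w(3)]] by blast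
      then show ?thesis using w True by (intro disjI1 exI[of _ "w @ [g]"]) simp
    next
      case False
      then have l: "length w = length y" using w by simp
      then have "hit y w" "c = verify_config A y w 2"
        using c0(2) nstep_query[OF l, of A c] w(3) by (auto simp: verify_config_def)
      then show ?thesis using l w by (intro disjI2 exI[of _ w] exI[of _ 2]) simp
    qed
  next
    fix w j
    assume w: "length w = length y" "hit y w" "2 \<le> j" "j \<le> 5" "k + 1 = length y + j"
      "j = 5 \<longrightarrow> w \<in> A" "c0 = verify_config A y w j"
    have "j = 2 \<or> j = 3 \<or> j = 4 \<or> j = 5" using w(3,4) by arith
    then have "j < 5 \<and> c = verify_config A y w (Suc j) \<and> (j = 4 \<longrightarrow> w \<in> A)"
      using c0(2) unfolding w(7)
      by (elim disjE) (simp_all add: verify_config_def nstep_answer nstep_return nstep_check nstep_final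
        query_track_tape_last)
    then show ?thesis using w by (intro disjI2 exI[of _ w] exI[of _ "Suc j"]) auto
  qed
qed

lemma hit_machine_guesses:
  "length w \<le> length y \<Longrightarrow> (nstep hit_machine A)\<^sup>*\<^sup>* (init_config hit_machine y) (guess_config y w)"
proof (induction w rule: rev_induct)
  case Nil
  then show ?case by (simp add: init_guess_config)
next
  case (snoc g w)
  then have "(nstep hit_machine A)\<^sup>*\<^sup>* (init_config hit_machine y) (guess_config y w)" by simp
  moreover have "nstep hit_machine A (guess_config y w) (guess_config y (w @ [g]))"
    using snoc.prems nstep_guess[of w y] by auto
  ultimately show ?case by (rule rtranclp.rtrancl_into_rtrancl)
qed

lemma hit_machine_accepts: "ntm_accepts hit_machine A y \<longleftrightarrow> y \<in> hit_lang A"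
proof
  assume "ntm_accepts hit_machine A y"
  then obtain c k where "(nstep hit_machine A ^^ k) (init_config hit_machine y) c" "cstate c = 5"
    unfolding ntm_accepts_def rtranclp_power by auto
  from hit_machine_reach[OF this(1)] this(2) show "y \<in> hit_lang A"
    by (auto simp: hit_lang_def guess_config_def verify_config_def of_bool_def split: if_splits)
next
  assume "y \<in> hit_lang A"
  then obtain x where x: "x \<in> A" "length x = length y" "hit y x" unfolding hit_lang_def by blast
  let ?n = "nstep hit_machine A"
  have "?n\<^sup>*\<^sup>* (init_config hit_machine y) (guess_config y x)"
    using x hit_machine_guesses by simp
  moreover have "?n (guess_config y x) (verify_config A y x 2)"
    using x by (simp add: nstep_query verify_config_def)
  moreover have "?n (verify_config A y x 2) (verify_config A y x 3)"
    by (simp add: nstep_answer verify_config_def)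
  moreover have "?n (verify_config A y x 3) (verify_config A y x 4)"
    by (simp add: nstep_return verify_config_def)
  moreover have "?n (verify_config A y x 4) (verify_config A y x 5)"
    using x(1,2) query_track_tape_last[of y x True] by (simp add: nstep_check verify_config_def)
  ultimately have "?n\<^sup>*\<^sup>* (init_config hit_machine y) (verify_config A y x 5)"
    by (meson rtranclp.rtrancl_into_rtrancl)
  then show "ntm_accepts hit_machine A y"
    unfolding ntm_accepts_def by (intro exI[of _ "verify_config A y x 5"]) (simp add: verify_config_def)
qed

lemma hit_lang_NP: "hit_lang A \<in> NP_str A"
proof -
  \<comment> \<open>The polynomial is \<open>n + 4\<close>: one step per guessed letter, then
    writing the target bit, calling, returning and checking.\<close>
  have "k \<le> poly [:4, 1:] (length y)"
    if "(nstep hit_machine A ^^ k) (init_config hit_machine y) c" for y k c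
    using hit_machine_reach[OF that] by auto
  then have "ntm_poly_time hit_machine A" unfolding ntm_poly_time_def by blast
  then show ?thesis
    unfolding NP_str_def using valid_hit_machine by (auto simp: hit_machine_accepts intro!: exI[of _ hit_machine])
qed

section \<open>There are only countably many machines\<close>

lemma countable_sym: "countable (UNIV :: sym set)"
proof (rule countable_subset)
  show "UNIV \<subseteq> {Blank} \<union> range Bit \<union> range Aux"
  proof
    show "a \<in> {Blank} \<union> range Bit \<union> range Aux" for a by (cases a) auto
  qed
  show "countable ({Blank} \<union> range Bit \<union> range Aux)" by auto
qed

lemma countable_cell: "countable (UNIV :: cell set)"
proof (rule countable_image_inj_on)
  have "countable ((UNIV :: sym set) \<times> (UNIV :: (bool option \<times> bool option) set))"
    using countable_sym by (intro countable_SIGMA) auto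
  then show "countable ((\<lambda>s :: cell. (work s, query s, ans s)) ` UNIV)"
    by (rule countable_subset[rotated]) auto
  show "inj (\<lambda>s :: cell. (work s, query s, ans s))" by (auto intro: injI)
qed

lemma countable_UNIV_prod:
  "countable (UNIV :: 'a set) \<Longrightarrow> countable (UNIV :: 'b set) \<Longrightarrow> countable (UNIV :: ('a \<times> 'b) set)"
  unfolding UNIV_Times_UNIV[symmetric] by (rule countable_SIGMA)

lemma countable_dir: "countable (UNIV :: dir set)"
  by (simp add: countable_finite)

text \<open>Transitions from or to anything outside \<open>states\<close> and \<open>cells\<close> are never used.  Once they are
  removed, a machine is determined by finitely many data.\<close>

definition restrict_ntm :: "ntm \<Rightarrow> ntm" where
  "restrict_ntm M = M\<lparr>delta := (\<lambda>q s. if q \<in> states M \<and> s \<in> cells M then delta M q s else {})\<rparr>"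

definition restricted_ntms :: "ntm set" where
  "restricted_ntms = {M. finite (states M) \<and> finite (alph M) \<and>
     (\<forall>q s u. u \<in> delta M q s \<longrightarrow> q \<in> states M \<and> s \<in> cells M \<and> u \<in> cells M \<times> states M \<times> UNIV)}"

text \<open>The graph of \<open>delta\<close> is finite for such a machine, so the codes lie in a
  product of countable families of finite sets.\<close>

lemma countable_restricted_ntms: "countable restricted_ntms"
proof -
  define G where "G M = {(q, s, u). u \<in> delta M q s}" for M :: ntm
  define code where "code M = (states M, alph M, (q_init M, q_final M, q_query M, q_answer M), G M)"
    for M :: ntm
  let ?F = "\<lambda>T. {X. finite X \<and> X \<subseteq> T}"
  let ?C = "?F (UNIV :: nat set) \<times> ?F (UNIV :: sym set) \<times> (UNIV :: (nat \<times> nat \<times> nat \<times> nat) set) \<times>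
    ?F (UNIV :: (nat \<times> cell \<times> cell \<times> nat \<times> dir) set)"
  have "inj_on code restricted_ntms"
  proof (rule inj_onI)
    fix M N :: ntm assume eq: "code M = code N"
    have "delta M = delta N"
    proof (intro ext set_eqI)
      fix q s u
      have "(q, s, u) \<in> G M \<longleftrightarrow> (q, s, u) \<in> G N" using eq unfolding code_def by blast
      then show "u \<in> delta M q s \<longleftrightarrow> u \<in> delta N q s" by (simp add: G_def)
    qed
    then show "M = N" using eq by (intro ntm.equality) (auto simp: code_def)
  qed
  moreover have "code ` restricted_ntms \<subseteq> ?C"
  proof -
    have "finite (G M)" if M: "M \<in> restricted_ntms" for M
    proof (rule finite_subset)
      show "G M \<subseteq> states M \<times> cells M \<times> cells M \<times> states M \<times> UNIV"
      proof
        fix z assume "z \<in> G M"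
        then obtain q s u where z: "z = (q, s, u)" "u \<in> delta M q s" unfolding G_def by blast
        then have "q \<in> states M" "s \<in> cells M" "u \<in> cells M \<times> states M \<times> UNIV"
          using M unfolding restricted_ntms_def by blast+
        then show "z \<in> states M \<times> cells M \<times> cells M \<times> states M \<times> UNIV"
          unfolding z(1) by (intro SigmaI)
      qed
      show "finite (states M \<times> cells M \<times> cells M \<times> states M \<times> (UNIV :: dir set))"
        using M finite_cells[of M] unfolding restricted_ntms_def by auto
    qed
    then show ?thesis by (auto simp: code_def restricted_ntms_def)
  qed
  moreover have "countable ?C"
    by (intro countable_SIGMA countable_Collect_finite_subset countable_UNIV_prod countable_sym
        countable_cell countable_dir) auto
  ultimately show ?thesis by (meson countable_image_inj_on countable_subset)
qed

lemma nstep_configs: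
  assumes M: "valid_ntm M" and c: "c \<in> configs M" and step: "nstep M A c c'"
  shows "c' \<in> configs M"
proof (cases "cstate c = q_query M")
  case True
  then show ?thesis
    using step oracle_call_configs[OF _ c] M by (auto simp: nstep_def valid_ntm_def)
next
  case False
  then obtain s q d where "(s, q, d) \<in> delta M (cstate c) (scanned c)" "c' = apply_move c s q d"
    using step unfolding nstep_def by auto
  moreover have "cstate c \<in> states M" "scanned c \<in> cells M"
    using c by (auto simp: configs_def scanned_def)
  ultimately have "s \<in> cells M" "q \<in> states M"
    using M unfolding valid_ntm_def by blast+
  then show ?thesis using apply_move_configs[OF c] \<open>c' = apply_move c s q d\<close> by blast
qed

lemma nstep_restrict:
  assumes "c \<in> configs M"
  shows "nstep (restrict_ntm M) A c c' \<longleftrightarrow> nstep M A c c'"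
  using assms
  by (simp add: nstep_def restrict_ntm_def configs_def scanned_def oracle_call_def)

text \<open>Runs stay inside \<open>configs M\<close>, where restriction changes no
  transition.\<close>

lemma nstep_restrict_power:
  assumes M: "valid_ntm M" and "(nstep M A ^^ k) (init_config M x) c"
  shows "(nstep (restrict_ntm M) A ^^ k) (init_config (restrict_ntm M) x) c \<and> c \<in> configs M"
  using assms(2)
proof (induction k arbitrary: c)
  case 0
  then show ?case
    using init_config_configs[of M x] M by (auto simp: valid_ntm_def init_config_def restrict_ntm_def)
next
  case (Suc k)
  then obtain b where b: "(nstep M A ^^ k) (init_config M x) b" "nstep M A b c" by auto
  then have b': "(nstep (restrict_ntm M) A ^^ k) (init_config (restrict_ntm M) x) b" "b \<in> configs M"
    using Suc.IH by auto
  then have "nstep (restrict_ntm M) A b c" using b(2) nstep_restrict by blast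
  then show ?case using b' nstep_configs[OF M _ b(2)] by auto
qed

section \<open>Countability of the computable amplitudes\<close>

definition approximates :: "ntm \<Rightarrow> real \<Rightarrow> bool" where
  "approximates M r \<longleftrightarrow> (\<forall>n. \<exists>k c w.
     (nstep M {} ^^ k) (init_config M (replicate n True)) c \<and> cstate c = q_final M \<and>
     work_output c w \<and> \<bar>r - real_of_int (signed_value w) / 2 ^ n\<bar> \<le> 1 / 2 ^ n)"

text \<open>Along a functional relation there is only one path from \<open>a\<close>, and it can end
  in only one dead end, whatever the lengths.\<close>

lemma relpowp_final_unique:
  assumes "\<And>a b b'. R a b \<Longrightarrow> R a b' \<Longrightarrow> b = b'"
    and "(R ^^ k) a c" "(R ^^ l) a c'" "\<And>b. \<not> R c b" "\<And>b. \<not> R c' b"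
  shows "c = c'"
  using assms(2,3)
proof (induction k arbitrary: a l)
  case 0
  then have "\<not> R a b" for b using assms(4) by simp
  then have "l = 0" using 0(2) by (cases l) (auto simp del: relpowp.simps(2) elim: relpowp_Suc_E2)
  then show ?case using 0 by simp
next
  case (Suc k)
  obtain b where b: "R a b" "(R ^^ k) b c" using Suc.prems(1) by (rule relpowp_Suc_E2)
  then obtain l' where l: "l = Suc l'" using Suc.prems(2) assms(5) by (cases l) auto
  then obtain b' where b': "R a b'" "(R ^^ l') b' c'"
    using Suc.prems(2) by (auto simp del: relpowp.simps(2) elim: relpowp_Suc_E2)
  then show ?case using Suc.IH b assms(1) by metis
qed

text \<open>The blank that ends the shorter word would have to be a letter of the longer
  one.\<close>

lemma work_output_unique:
  assumes "work_output c w" "work_output c v"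
  shows "w = v"
proof -
  have "\<not> length w < length v" "\<not> length v < length w"
    using assms by (auto simp: work_output_def)
  then have "length w = length v" by simp
  then show ?thesis using assms by (auto simp: work_output_def list_eq_iff_nth_eq)
qed

text \<open>For each \<open>n\<close> both numbers are approximated by the same output, so they are
  within \<open>2 / 2 ^ n\<close> of each other.\<close>

lemma approximates_unique:
  assumes det: "\<And>q s u v. u \<in> delta M q s \<Longrightarrow> v \<in> delta M q s \<Longrightarrow> u = v"
    and r: "approximates M r" "approximates M r'"
  shows "r = r'"
proof -
  have functional: "b = b'" if "nstep M {} a b" "nstep M {} a b'" for a b b'
    using that det unfolding nstep_def by (fastforce split: if_splits)
  have close: "\<bar>r - r'\<bar> \<le> 2 * (1 / 2) ^ n" for n
  proof -
    obtain k c w where 1: "(nstep M {} ^^ k) (init_config M (replicate n True)) c" "cstate c = q_final M"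
      "work_output c w" "\<bar>r - real_of_int (signed_value w) / 2 ^ n\<bar> \<le> 1 / 2 ^ n"
      using r(1) unfolding approximates_def by blast
    obtain k' c' w' where 2: "(nstep M {} ^^ k') (init_config M (replicate n True)) c'" "cstate c' = q_final M"
      "work_output c' w'" "\<bar>r' - real_of_int (signed_value w') / 2 ^ n\<bar> \<le> 1 / 2 ^ n"
      using r(2) unfolding approximates_def by blast
    have "c = c'"
      by (rule relpowp_final_unique[OF functional 1(1) 2(1)]) (use 1(2) 2(2) in \<open>auto simp: nstep_def\<close>)
    then have "w = w'" using work_output_unique 1(3) 2(3) by blast
    then have "\<bar>r - r'\<bar> \<le> 2 * (1 / 2 ^ n)" using 1(4)[unfolded \<open>w = w'\<close>] 2(4) by linarith
    then show ?thesis by (simp add: power_one_over)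
  qed
  have "(\<lambda>n. 2 * (1 / 2 :: real) ^ n) \<longlonglongrightarrow> 0"
    by (intro tendsto_mult_right_zero LIMSEQ_power_zero) simp
  then have "\<bar>r - r'\<bar> \<le> 0"
    by (rule LIMSEQ_le_const) (use close in blast)
  then show ?thesis by simp
qed

text \<open>Each computable real is approximated by a restricted deterministic machine, and each
  such machine approximates at most one real.\<close>

lemma countable_poly_time_real: "countable {r. poly_time_real r}"
proof (rule countable_subset)
  let ?D = "{M \<in> restricted_ntms. \<forall>q s. \<forall>u\<in>delta M q s. \<forall>v\<in>delta M q s. u = v}"
  show "{r. poly_time_real r} \<subseteq> (\<Union>M\<in>?D. {r. approximates M r})"
  proof
    fix r assume "r \<in> {r. poly_time_real r}"
    then obtain M where M: "valid_ntm M" "deterministic M"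
      and r: "\<And>n. \<exists>k c w. (nstep M {} ^^ k) (init_config M (replicate n True)) c \<and>
        cstate c = q_final M \<and> work_output c w \<and> \<bar>r - real_of_int (signed_value w) / 2 ^ n\<bar> \<le> 1 / 2 ^ n"
      unfolding poly_time_real_def by blast
    have q: "q_final (restrict_ntm M) = q_final M" by (simp add: restrict_ntm_def)
    have "approximates (restrict_ntm M) r"
      unfolding approximates_def q using r nstep_restrict_power[OF M(1)] by meson
    moreover have "restrict_ntm M \<in> ?D"
    proof -
      have "cells (restrict_ntm M) = cells M" by (simp add: cells_def restrict_ntm_def)
      then have "restrict_ntm M \<in> restricted_ntms"
        using M(1) unfolding restricted_ntms_def valid_ntm_def valid_machine_def
        by (auto simp: restrict_ntm_def split: if_splits)
      moreover have "u = v"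
        if "u \<in> delta (restrict_ntm M) q s" "v \<in> delta (restrict_ntm M) q s" for q s u v
      proof -
        have "q \<in> states M" "s \<in> cells M" "u \<in> delta M q s" "v \<in> delta M q s"
          using that by (simp_all add: restrict_ntm_def split: if_splits)
        then show ?thesis using M(2) unfolding deterministic_def by blast
      qed
      ultimately show ?thesis by blast
    qed
    ultimately show "r \<in> (\<Union>M\<in>?D. {r. approximates M r})" by blast
  qed
  show "countable (\<Union>M\<in>?D. {r. approximates M r})"
  proof (rule countable_UN)
    show "countable ?D" by (rule countable_subset[OF _ countable_restricted_ntms]) blast
    fix M assume M: "M \<in> ?D"
    then have det: "u = v" if "u \<in> delta M q s" "v \<in> delta M q s" for q s u v
      using that by blast
    show "countable {r. approximates M r}"
    proof (cases "\<exists>r. approximates M r")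
      case True
      then obtain r where "approximates M r" by blast
      have "r' = r" if "approximates M r'" for r'
        by (rule approximates_unique[OF _ that \<open>approximates M r\<close>]) (rule det)
      then have "{r. approximates M r} \<subseteq> {r}" by blast
      then show ?thesis by (rule countable_subset) simp
    qed simp
  qed
qed

lemma countable_poly_time_complex: "countable {z. poly_time_complex z}"
proof (rule countable_subset)
  let ?R = "{r. poly_time_real r}"
  show "{z. poly_time_complex z} \<subseteq> (\<lambda>(a, b). Complex a b) ` (?R \<times> ?R)"
  proof
    fix z assume "z \<in> {z. poly_time_complex z}"
    then have "(Re z, Im z) \<in> ?R \<times> ?R" by (simp add: poly_time_complex_def)
    moreover have "z = (\<lambda>(a, b). Complex a b) (Re z, Im z)" by simp
    ultimately show "z \<in> (\<lambda>(a, b). Complex a b) ` (?R \<times> ?R)" by (rule rev_image_eqI)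
  qed
  show "countable ((\<lambda>(a, b). Complex a b) ` (?R \<times> ?R))"
    using countable_poly_time_real by (intro countable_image countable_SIGMA)
qed

section \<open>Countability of the quantum machines\<close>

definition restrict_qtm :: "qtm \<Rightarrow> qtm" where
  "restrict_qtm M = M\<lparr>amp := (\<lambda>p s t q d.
     if p \<in> states M \<and> s \<in> cells M \<and> t \<in> cells M \<and> q \<in> states M then amp M p s t q d else 0)\<rparr>"

definition restricted_qtms :: "qtm set" where
  "restricted_qtms = {M. finite (states M) \<and> finite (alph M) \<and>
     (\<forall>p s t q d. amp M p s t q d \<noteq> 0 \<longrightarrow> p \<in> states M \<and> s \<in> cells M \<and> t \<in> cells M \<and> q \<in> states M \<and>
        poly_time_complex (amp M p s t q d))}"

text \<open>Computability of the amplitudes enters here: a machine is coded by finite sets over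
  countable types together with amplitudes from a countable set.\<close>

lemma countable_restricted_qtms: "countable restricted_qtms"
proof -
  define G where "G M = {(p, s, t, q, d, a). a = amp M p s t q d \<and> a \<noteq> 0}" for M :: qtm
  define code where "code M = (states M, alph M, (q_init M, q_final M, q_query M, q_answer M), G M)"
    for M :: qtm
  let ?F = "\<lambda>T. {X. finite X \<and> X \<subseteq> T}"
  let ?T = "(UNIV :: nat set) \<times> (UNIV :: cell set) \<times> (UNIV :: cell set) \<times> (UNIV :: nat set) \<times>
    (UNIV :: dir set) \<times> {z. poly_time_complex z}"
  let ?C = "?F (UNIV :: nat set) \<times> ?F (UNIV :: sym set) \<times> (UNIV :: (nat \<times> nat \<times> nat \<times> nat) set) \<times> ?F ?T"
  have "inj_on code restricted_qtms"
  proof (rule inj_onI)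
    fix M N :: qtm assume eq: "code M = code N"
    have G: "(p, s, t, q, d, a) \<in> G M \<longleftrightarrow> (p, s, t, q, d, a) \<in> G N" for p s t q d a
      using eq unfolding code_def by blast
    have "amp M p s t q d = amp N p s t q d" for p s t q d
      \<comment> \<open>The graphs omit zero amplitudes to stay finite. If the two values differed,
        one would be non-zero, so both are tested.\<close>
      using G[of p s t q d "amp M p s t q d"] G[of p s t q d "amp N p s t q d"] unfolding G_def by auto
    then have "amp M = amp N" by (intro ext)
    then show "M = N" using eq by (intro qtm.equality) (auto simp: code_def)
  qed
  moreover have "code ` restricted_qtms \<subseteq> ?C"
  proof -
    have "finite (G M) \<and> G M \<subseteq> ?T" if M: "M \<in> restricted_qtms" for M
    proof
      let ?D = "states M \<times> cells M \<times> cells M \<times> states M \<times> (UNIV :: dir set)"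
      show "finite (G M)"
      proof (rule finite_subset)
        show "G M \<subseteq> (\<lambda>(p, s, t, q, d). (p, s, t, q, d, amp M p s t q d)) ` ?D"
          using M unfolding G_def restricted_qtms_def by (auto simp: image_iff)
        show "finite ((\<lambda>(p, s, t, q, d). (p, s, t, q, d, amp M p s t q d)) ` ?D)"
          using M finite_cells[of M] unfolding restricted_qtms_def by auto
      qed
      show "G M \<subseteq> ?T" using M unfolding G_def restricted_qtms_def by auto
    qed
    then show ?thesis by (auto simp: code_def restricted_qtms_def)
  qed
  moreover have "countable ?C"
    by (intro countable_SIGMA countable_Collect_finite_subset countable_cell countable_sym countable_dir
        countable_poly_time_complex) auto
  ultimately show ?thesis by (meson countable_image_inj_on countable_subset)
qed

lemma restrict_qtm_sel [simp]:
  "states (restrict_qtm M) = states M" "alph (restrict_qtm M) = alph M"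
  "q_init (restrict_qtm M) = q_init M" "q_final (restrict_qtm M) = q_final M"
  "q_query (restrict_qtm M) = q_query M" "q_answer (restrict_qtm M) = q_answer M"
  "cells (restrict_qtm M) = cells M" "configs (restrict_qtm M) = configs M"
  "superpositions (restrict_qtm M) = superpositions M"
  "valid_machine (restrict_qtm M) = valid_machine M"
  by (simp_all add: restrict_qtm_def cells_def configs_def superpositions_def valid_machine_def)

text \<open>The support of \<open>\<psi>\<close> lies in \<open>configs M\<close>, where only
  unchanged amplitudes are read.\<close>

lemma evolve_restrict:
  assumes "\<psi> \<in> superpositions M"
  shows "evolve (restrict_qtm M) A \<psi> = evolve M A \<psi>"
proof -
  have "step_amp (restrict_qtm M) A c c' = step_amp M A c c'" if "\<psi> c \<noteq> 0" for c c'
  proof -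
    have "c \<in> configs M" using superpositionsD(2)[OF assms that] .
    then have c: "cstate c \<in> states M" "scanned c \<in> cells M" by (auto simp: configs_def scanned_def)
    have "(\<Sum>(t, q, d) \<in> cells M \<times> states M \<times> UNIV.
        of_bool (c' = apply_move c t q d) * amp (restrict_qtm M) (cstate c) (scanned c) t q d) =
      (\<Sum>(t, q, d) \<in> cells M \<times> states M \<times> UNIV.
        of_bool (c' = apply_move c t q d) * amp M (cstate c) (scanned c) t q d)"
      using c by (intro sum.cong) (auto simp: restrict_qtm_def)
    then show ?thesis by (simp add: step_amp_def oracle_call_def)
  qed
  then show ?thesis unfolding evolve_def by (intro ext sum.cong) auto
qed

lemma run_restrict:
  assumes M: "valid_machine M"
  shows "run (restrict_qtm M) A x k = run M A x k"
proof (induction k)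
  case 0
  show ?case by (simp add: run_0 init_config_def)
next
  case (Suc k)
  then show ?case using evolve_restrict[OF run_superpositions[OF M]] by (simp add: run_Suc)
qed

lemma well_formed_restrict: "well_formed (restrict_qtm M) A \<longleftrightarrow> well_formed M A"
  by (simp add: well_formed_def evolve_restrict)

lemma reveals_restrict:
  "valid_machine M \<Longrightarrow> reveals (restrict_qtm M) A T x \<longleftrightarrow> reveals M A T x"
  by (simp add: reveals_def halts_at_def accept_prob_def run_restrict)

lemma restrict_qtm_restricted: "valid_qtm M \<Longrightarrow> restrict_qtm M \<in> restricted_qtms"
  unfolding restricted_qtms_def
  by (auto simp: valid_qtm_def valid_machine_def) (auto simp: restrict_qtm_def split: if_splits)

section \<open>The diagonal construction\<close>

lemma poly_nat_less_power2:
  fixes p :: "nat poly"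
  shows "\<forall>\<^sub>F n in sequentially. poly p n < 2 ^ n"
proof -
  have lim: "(\<lambda>n. real n ^ k / 2 ^ n) \<longlonglongrightarrow> 0" for k
  proof -
    \<comment> \<open>Since \<open>2 ^ n = exp (ln 2 * n)\<close>, the limit comes from
      \<open>t ^ k / exp t\<close> at \<open>t = ln 2 * n\<close>; the factor
      \<open>(1 / ln 2) ^ k\<close> corrects the numerator.\<close>
    have "filterlim (\<lambda>n. ln 2 * real n) at_top sequentially"
      by (intro filterlim_tendsto_pos_mult_at_top[OF tendsto_const] filterlim_real_sequentially) simp
    then have "(\<lambda>n. (ln 2 * real n) ^ k / exp (ln 2 * real n)) \<longlonglongrightarrow> 0"
      by (rule filterlim_compose[OF tendsto_power_div_exp_0])
    then have "(\<lambda>n. (1 / ln 2) ^ k * ((ln 2 * real n) ^ k / exp (ln 2 * real n))) \<longlonglongrightarrow> 0"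
      by (rule tendsto_mult_right_zero)
    moreover have "(1 / ln 2) ^ k * ((ln 2 * real n) ^ k / exp (ln 2 * real n)) = real n ^ k / 2 ^ n" for n
    proof -
      have "exp (ln 2 * real n) = (2 :: real) ^ n" by (simp add: exp_of_nat2_mult)
      then show ?thesis by (simp add: power_mult_distrib power_one_over)
    qed
    ultimately show ?thesis by simp
  qed
  have "(\<lambda>n. \<Sum>i\<le>degree p. real (coeff p i) * (real n ^ i / 2 ^ n)) \<longlonglongrightarrow> 0"
    by (intro tendsto_null_sum tendsto_mult_right_zero lim)
  moreover have "(\<Sum>i\<le>degree p. real (coeff p i) * (real n ^ i / 2 ^ n)) = real (poly p n) / 2 ^ n" for n
    by (simp add: poly_altdef sum_divide_distrib)
  ultimately have "(\<lambda>n. real (poly p n) / 2 ^ n) \<longlonglongrightarrow> 0" by simp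
  then have "\<forall>\<^sub>F n in sequentially. real (poly p n) / 2 ^ n < 1"
    by (rule order_tendstoD) simp
  then show ?thesis
  proof eventually_elim
    case (elim n)
    then have "real (poly p n) < real (2 ^ n)" by simp
    then show ?case by (simp only: of_nat_less_iff)
  qed
qed

text \<open>A union bound: each machine with its time bound and each \<open>F\<close> rules out
  polynomially many words of length \<open>n\<close>, out of \<open>2 ^ n\<close>.\<close>

lemma exists_unrevealed:
  assumes "finite E" "finite G"
    and E: "\<And>M p. (M, p) \<in> E \<Longrightarrow> valid_machine M \<and> (\<forall>A. well_formed M A)"
  shows "\<exists>x. N < length x \<and>
    (\<forall>(M, p)\<in>E. \<forall>F. F \<subseteq> G \<longrightarrow> \<not> reveals M (insert x F) (poly p (length x)) x)"
proof -
  define I where "I = E \<times> Pow G"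
  have "finite I" using assms(1,2) by (simp add: I_def)
  \<comment> \<open>The bounds of \<open>card_reveals\<close> for \<open>T = poly p n\<close>,
    summed over \<open>I\<close> and written as one polynomial in \<open>n\<close>.\<close>
  define q :: "nat poly" where "q = (\<Sum>((M, p), F)\<in>I. 1 + [:0, 1:] * (625 * (p + 1) ^ 3))"
  have q: "poly q n = (\<Sum>((M, p), F)\<in>I. 1 + n * (625 * (poly p n + 1) ^ 3))" for n
    unfolding q_def poly_sum by (intro sum.cong) (auto simp: poly_power)
  have "\<forall>\<^sub>F n in sequentially. poly q n < 2 ^ n \<and> N < n"
    by (intro eventually_conj poly_nat_less_power2 eventually_gt_at_top)
  then obtain n where n: "poly q n < 2 ^ n" "N < n"
    using eventually_happens'[OF sequentially_bot] by blast
  define bad where "bad = (\<lambda>((M, p), F). {x. length x = n \<and> reveals M (insert x F) (poly p n) x})"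
  have fin_n: "finite {x :: bool list. length x = n}"
    using finite_lists_length_eq[of "UNIV :: bool set" n] by simp
  have bad_le: "card (bad ((M, p), F)) \<le> 1 + n * (625 * (poly p n + 1) ^ 3)" if "(M, p) \<in> E" for M p F
    using card_reveals[of M n F "poly p n"] E[OF that] by (simp add: bad_def)
  have "card (\<Union>u\<in>I. bad u) \<le> (\<Sum>u\<in>I. card (bad u))" by (rule card_UN_le[OF \<open>finite I\<close>])
  also have "\<dots> \<le> poly q n"
    unfolding q by (intro sum_mono) (clarsimp simp: I_def bad_le simp del: One_nat_def)
  also have "\<dots> < 2 ^ n" by (rule n(1))
  also have "\<dots> = card {x :: bool list. length x = n}"
    using card_lists_length_eq[of "UNIV :: bool set" n] by simp
  finally have less: "card (\<Union>u\<in>I. bad u) < card {x :: bool list. length x = n}" .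
  have "finite (\<Union>u\<in>I. bad u)"
    by (rule finite_subset[OF _ fin_n]) (auto simp: bad_def)
  then have "\<not> {x :: bool list. length x = n} \<subseteq> (\<Union>u\<in>I. bad u)"
    using less card_mono leD by blast
  then obtain x where x: "length x = n" "x \<notin> (\<Union>u\<in>I. bad u)" by blast
  have "\<not> reveals M (insert x F) (poly p (length x)) x" if "(M, p) \<in> E" "F \<subseteq> G" for M p F
  proof -
    have "((M, p), F) \<in> I" using that by (simp add: I_def)
    then show ?thesis using x unfolding bad_def by fastforce
  qed
  then show ?thesis using x(1) n(2) by (intro exI[of _ x]) auto
qed

text \<open>Dependent choice in which each stage sees the set of all earlier values.\<close>

lemma history_choice:
  assumes "\<And>k G. finite G \<Longrightarrow> \<exists>y. P k G y"
  shows "\<exists>x. \<forall>k::nat. P k (x ` {..<k}) (x k)"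
proof -
  define G where "G = rec_nat {} (\<lambda>k G. insert (SOME y. P k G y) G)"
  define x where "x k = (SOME y. P k (G k) y)" for k
  have G: "G 0 = {}" "G (Suc k) = insert (x k) (G k)" for k by (simp_all add: G_def x_def)
  have img: "G k = x ` {..<k}" for k by (induction k) (auto simp: G lessThan_Suc)
  have "P k (G k) (x k)" for k
  proof -
    have "\<exists>y. P k (G k) y" using assms[of "G k" k] by (simp add: img)
    then show ?thesis unfolding x_def by (rule someI_ex)
  qed
  then show ?thesis unfolding img by blast
qed

lemma countable_nat_poly: "countable (UNIV :: nat poly set)"
proof (rule countable_image_inj_on)
  show "countable (range (coeffs :: nat poly \<Rightarrow> nat list))" by simp
  show "inj (coeffs :: nat poly \<Rightarrow> nat list)" by (auto intro: injI simp: coeffs_eq_iff)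
qed

lemma exists_hiding_sequence:
  "\<exists>x :: nat \<Rightarrow> bool list. (\<forall>i j. i < j \<longrightarrow> length (x i) < length (x j)) \<and>
    (\<forall>A. infinite A \<and> A \<subseteq> range x \<longrightarrow> hit_lang A \<notin> BQP_str A)"
proof -
  \<comment> \<open>Well-formedness for every oracle keeps this family independent of the oracle
    \<open>A\<close> to be treated later.\<close>
  define \<C> where "\<C> = {M \<in> restricted_qtms. valid_machine M \<and> (\<forall>A. well_formed M A)}"
  define D where "D = \<C> \<times> (UNIV :: nat poly set)"
  have "countable \<C>"
    by (rule countable_subset[OF _ countable_restricted_qtms]) (auto simp: \<C>_def)
  then have "countable D" unfolding D_def by (intro countable_SIGMA countable_nat_poly)
  then obtain f :: "_ \<Rightarrow> nat" where f: "inj_on f D" by (rule countableE)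
  \<comment> \<open>The sets \<open>E k\<close> increase, so a pair is defeated at every stage from
    its index on. This matters because \<open>A\<close> may skip any particular stage.\<close>
  define E where "E k = {d \<in> D. f d \<le> k}" for k
  have finE: "finite (E k)" for k
  proof (rule finite_imageD)
    show "finite (f ` E k)" by (rule finite_subset[of _ "{..k}"]) (auto simp: E_def)
    show "inj_on f (E k)" by (rule inj_on_subset[OF f]) (auto simp: E_def)
  qed
  \<comment> \<open>The first clause puts \<open>y\<close> out of reach of runs on inputs as long as
    earlier words. The second defeats all current machines for every set of earlier words.\<close>
  define P where "P k G y \<longleftrightarrow>
      (\<forall>g\<in>G. length g < length y \<and> (\<forall>(M, p)\<in>E k. poly p (length g) < length y)) \<and>
      (\<forall>(M, p)\<in>E k. \<forall>F. F \<subseteq> G \<longrightarrow> \<not> reveals M (insert y F) (poly p (length y)) y)"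
    for k G and y :: "bool list"
  have "\<exists>y. P k G y" if G: "finite G" for k G
  proof -
    \<comment> \<open>A sum dominates each of its terms, so this single number exceeds or equals
      every length and time bound in the first clause.\<close>
    define N where "N = (\<Sum>g\<in>G. length g + (\<Sum>(M, p)\<in>E k. poly p (length g)))"
    obtain y where y: "N < length y"
      "\<forall>(M, p)\<in>E k. \<forall>F. F \<subseteq> G \<longrightarrow> \<not> reveals M (insert y F) (poly p (length y)) y"
      using exists_unrevealed[OF finE G, of k N] by (auto simp: E_def D_def \<C>_def)
    have "length g < length y \<and> (\<forall>(M, p)\<in>E k. poly p (length g) < length y)" if g: "g \<in> G" for g
    proof -
      have "length g + (\<Sum>(M, p)\<in>E k. poly p (length g)) \<le> N"
        unfolding N_def by (rule member_le_sum[OF g _ G]) simp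
      moreover have "poly p (length g) \<le> (\<Sum>(M, p)\<in>E k. poly p (length g))" if "(M, p) \<in> E k" for M p
        using member_le_sum[OF that _ finE, of "\<lambda>(M, p). poly p (length g)"] by simp
      ultimately show ?thesis using y(1) by fastforce
    qed
    then show ?thesis unfolding P_def using y(2) by blast
  qed
  then obtain x where x: "\<And>k. P k (x ` {..<k}) (x k)"
    using history_choice[of P] by blast
  have mono: "length (x i) < length (x j)" if "i < j" for i j
    using x[of j] that unfolding P_def by blast
  have "hit_lang A \<notin> BQP_str A" if A: "infinite A" "A \<subseteq> range x" for A
  proof
    assume "hit_lang A \<in> BQP_str A"
    then obtain M where M: "valid_qtm M" "well_formed M A" "qtm_poly_time M A"
      "qtm_accepts_lang M A (hit_lang A) (2/3)" unfolding BQP_str_def by blast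
    then obtain p :: "nat poly" where p: "\<And>y. \<exists>T\<le>poly p (length y). halts_at M A y T"
      unfolding qtm_poly_time_def by blast
    have vM: "valid_machine M" using M(1) by (simp add: valid_qtm_def)
    define M' where "M' = restrict_qtm M"
    have "M' \<in> \<C>"
      using restrict_qtm_restricted[OF M(1)] vM well_formed_oracle[OF vM M(2)]
      unfolding \<C>_def M'_def mem_Collect_eq well_formed_restrict restrict_qtm_sel by blast
    then have d: "(M', p) \<in> D" by (simp add: D_def)
    \<comment> \<open>Infinitude of \<open>A\<close> provides a stage beyond the index of
      \<open>(M', p)\<close> whose word belongs to \<open>A\<close>.\<close>
    have "infinite {k. x k \<in> A}"
    proof
      assume "finite {k. x k \<in> A}"
      moreover have "A = x ` {k. x k \<in> A}" using A(2) by blast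
      ultimately show False using A(1) finite_imageI by metis
    qed
    then obtain k where k: "f (M', p) \<le> k" "x k \<in> A"
      by (auto simp: infinite_nat_iff_unbounded_le)
    define n where "n = length (x k)"
    \<comment> \<open>As \<open>x k\<close> is the only word of length \<open>n\<close> in
      \<open>A\<close>, membership of the unit words in \<open>hit_lang A\<close> reads off its
      letters.\<close>
    have only: "w = x k" if "w \<in> A" "length w = n" for w
    proof -
      obtain j where j: "w = x j" using \<open>w \<in> A\<close> A(2) by blast
      have "\<not> j < k" "\<not> k < j" using mono[of j k] mono[of k j] that(2) by (auto simp: j n_def)
      then show ?thesis by (simp add: j)
    qed
    have "reveals M A (poly p n) (x k)"
      unfolding reveals_def n_def[symmetric]
    proof (intro allI impI)
      fix i assume i: "i < n"
      let ?y = "unit_word n i"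
      have ly: "length ?y = n" by (simp add: unit_word_def)
      obtain T where T: "T \<le> poly p n" "halts_at M A ?y T" using p[of ?y] ly by auto
      have "hit ?y (x k) \<longleftrightarrow> x k ! i"
        using i by (auto simp: hit_def unit_word_def n_def[symmetric] nth_list_update split: if_splits)
      moreover have "?y \<in> hit_lang A \<longleftrightarrow> hit ?y (x k)"
        unfolding hit_lang_def mem_Collect_eq ly using only k(2) n_def by metis
      ultimately have "?y \<in> hit_lang A \<longleftrightarrow> x k ! i" by simp
      then have "if x k ! i then accept_prob M A ?y T \<ge> 2/3 else accept_prob M A ?y T \<le> 1/3"
        using M(4) T(2) unfolding qtm_accepts_lang_def by fastforce
      then show "\<exists>T\<le>poly p n. halts_at M A ?y T \<and>
        (if x k ! i then accept_prob M A ?y T \<ge> 2/3 else accept_prob M A ?y T \<le> 1/3)"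
        using T by blast
    qed
    then have "reveals M' A (poly p n) (x k)" by (simp add: M'_def reveals_restrict[OF vM])
    moreover define F where "F = A \<inter> x ` {..<k}"
    \<comment> \<open>Below length \<open>poly p n\<close> the oracle contains no later word of the
      sequence, by the growth clause in \<open>P\<close>; its earlier words form
      \<open>F\<close>.\<close>
    have "w \<in> A \<longleftrightarrow> w \<in> insert (x k) F" if w: "length w < poly p n" for w
    proof
      assume "w \<in> A"
      then obtain j where j: "w = x j" using A(2) by blast
      have "\<not> k < j"
      proof
        assume "k < j"
        then have "(M', p) \<in> E j" "x k \<in> x ` {..<j}" using d k(1) by (auto simp: E_def)
        then have "poly p n < length (x j)" using x[of j] unfolding P_def n_def by blast
        then show False using w j by simp
      qed
      then have "j = k \<or> j < k" by arith
      then show "w \<in> insert (x k) F" using \<open>w \<in> A\<close> j by (auto simp: F_def)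
    qed (use k(2) in \<open>auto simp: F_def\<close>)
    ultimately have "reveals M' (insert (x k) F) (poly p n) (x k)"
      using reveals_oracle_cong by blast
    moreover have "\<forall>(M, p)\<in>E k. \<forall>F. F \<subseteq> x ` {..<k} \<longrightarrow>
        \<not> reveals M (insert (x k) F) (poly p (length (x k))) (x k)"
      using x[of k] unfolding P_def by (rule conjunct2)
    then have "\<forall>F. F \<subseteq> x ` {..<k} \<longrightarrow> \<not> reveals M' (insert (x k) F) (poly p n) (x k)"
      using d k(1) unfolding n_def by (auto simp: E_def)
    then have "\<not> reveals M' (insert (x k) F) (poly p n) (x k)"
      unfolding F_def by blast
    ultimately show False by (rule notE[rotated])
  qed
  then show ?thesis using mono by (intro exI[of _ x]) simp
qed

theorem theorem3p5:
  shows "ramsey_positive {K. infinite K \<and> \<not> NP K \<subseteq> BQP K} \<and>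
    (\<exists>H. infinite H \<and> (\<forall>C. infinite C \<and> C \<subseteq> H \<longrightarrow> \<not> NP C \<subseteq> BQP C))"
proof -
  obtain x :: "nat \<Rightarrow> bool list" where x: "\<And>i j. i < j \<Longrightarrow> length (x i) < length (x j)"
    "\<And>A. infinite A \<Longrightarrow> A \<subseteq> range x \<Longrightarrow> hit_lang A \<notin> BQP_str A"
    using exists_hiding_sequence by blast
  have "inj x"
  proof (rule injI)
    fix i j assume "x i = x j"
    then have "\<not> i < j" "\<not> j < i" using x(1)[of i j] x(1)[of j i] by auto
    then show "i = j" by simp
  qed
  \<comment> \<open>Because \<open>bin_str\<close> is a bijection, the infinite subsets of
    \<open>H\<close> correspond to the infinite sets of words from the sequence.\<close>
  define H where "H = bin_str -` range x"
  have "bin_str ` H = range x"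
    using bij_bin_str unfolding H_def by (simp add: bij_is_surj surj_image_vimage_eq)
  moreover have "infinite (range x)" using \<open>inj x\<close> by (simp add: finite_image_iff)
  ultimately have H: "infinite H" using finite_imageI by metis
  have "\<not> NP C \<subseteq> BQP C" if "infinite C" "C \<subseteq> H" for C
  proof -
    have "inj_on bin_str C" using bij_bin_str by (meson bij_is_inj inj_on_subset subset_UNIV)
    then have "infinite (bin_str ` C)" using that(1) by (simp add: finite_image_iff)
    moreover have "bin_str ` C \<subseteq> range x" using that(2) by (auto simp: H_def)
    ultimately show ?thesis
      using x(2) hit_lang_NP unfolding NP_def BQP_def by blast
  qed
  then show ?thesis
    using H not_ramsey_small[OF H, of "{K. infinite K \<and> \<not> NP K \<subseteq> BQP K}"]
    unfolding ramsey_positive_def by blast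
qed

end
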